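(* The problem \textsc{Trivially Perfect Completion} admits a proper kernel with $O(k^7)$ vertices. That is, there is a polynomial-time algorithm that, given an instance $(G,k)$ of \textsc{Trivially Perfect Completion}, outputs an instance $(G',k')$ such that $(G,k)$ is a yes-instance if and only if $(G',k')$ is a yes-instance, $k'\le k$, and $|V(G')|\le c\cdot k^7$ for an absolute constant $c$.
   Context: All graphs are finite, simple and undirected. A graph is trivially perfect if it contains neither $C_4$ nor $P_4$ as an induced subgraph. \textsc{Trivially Perfect Completion}: given a graph $G$ and a non-negative integer $k$ (the parameter), decide whether there is a set $S\subseteq\binom{V(G)}{2}\setminus E(G)$ with $|S|\le k$ such that the graph $(V(G),E(G)\cup S)$ is trivially perfect. A kernel is a polynomial-time algorithm mapping an instance $(G,k)$ to an equivalent instance $(G',k')$ whose size is bounded by a function of $k$; it is proper if moreover $k'\le k$.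
   Formalization: The bound is stated as |V(G')| ≤ c·max(1,k)^7: for k = 0 the inequality |V(G')| ≤ c·k^7 would force G' to be empty, a yes-instance, although (P_4, 0) is a no-instance; for k ≥ 1 it is c·k^7. *)

theory Defs
  imports "HOL-Library.Ramsey" "HOL-Computational_Algebra.Polynomial"
begin

section \<open>Graphs\<close>

type_synonym 'a graph = "'a set \<times> 'a set set"

abbreviation verts :: "'a graph \<Rightarrow> 'a set" where "verts \<equiv> fst"
abbreviation edges :: "'a graph \<Rightarrow> 'a set set" where "edges \<equiv> snd"

text \<open>Finite simple undirected graphs; \<open>[V]\<^bsup>2\<^esup>\<close> is the library's set of 2-element subsets of \<open>V\<close>.\<close>

definition simple_graph :: "'a graph \<Rightarrow> bool" where
  "simple_graph G \<longleftrightarrow> finite (verts G) \<and> edges G \<subseteq> [verts G]\<^bsup>2\<^esup>"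

definition induced_subgraph :: "'a graph \<Rightarrow> 'a set \<Rightarrow> 'a graph" where
  "induced_subgraph G U = (U, {e \<in> edges G. e \<subseteq> U})"

definition isomorphic :: "'a graph \<Rightarrow> 'b graph \<Rightarrow> bool" where
  "isomorphic G H \<longleftrightarrow>
     (\<exists>f. bij_betw f (verts G) (verts H) \<and> edges H = (\<lambda>e. f ` e) ` edges G)"

definition contains_induced :: "'a graph \<Rightarrow> 'b graph \<Rightarrow> bool" where
  "contains_induced G H \<longleftrightarrow> (\<exists>U \<subseteq> verts G. isomorphic (induced_subgraph G U) H)"

definition P4 :: "nat graph" where
  "P4 = ({0, 1, 2, 3}, {{0, 1}, {1, 2}, {2, 3}})"

definition C4 :: "nat graph" where
  "C4 = ({0, 1, 2, 3}, {{0, 1}, {1, 2}, {2, 3}, {3, 0}})"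

definition trivially_perfect :: "'a graph \<Rightarrow> bool" where
  "trivially_perfect G \<longleftrightarrow> \<not> contains_induced G C4 \<and> \<not> contains_induced G P4"


section \<open>Trivially Perfect Completion\<close>

definition TPC :: "'a graph \<Rightarrow> nat \<Rightarrow> bool" where
  "TPC G k \<longleftrightarrow>
     (\<exists>S \<subseteq> [verts G]\<^bsup>2\<^esup> - edges G. card S \<le> k \<and> trivially_perfect (verts G, edges G \<union> S))"

text \<open>
  As inputs and outputs of algorithms, graphs on \<open>n\<close> vertices have vertex set \<open>{0, \<dots>, n - 1}\<close>.
\<close>

definition graph_instances :: "(nat graph \<times> nat) set" where
  "graph_instances = {(G, k). simple_graph G \<and> (\<exists>n. verts G = {..<n})}"

text \<open>Binary representation, most significant bit first, without leading zeros.\<close>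

fun binary :: "nat \<Rightarrow> bool list" where
  "binary n = (if n = 0 then [] else binary (n div 2) @ [odd n])"

declare binary.simps [simp del]

text \<open>
  An instance is written as the number of vertices in unary, terminated by a zero bit, the adjacency
  matrix row by row, and the parameter in binary. The length of the encoding is
  \<open>n\<^sup>2 + n + 1\<close> plus the bit length of the parameter.
\<close>

definition encode :: "nat graph \<times> nat \<Rightarrow> bool list" where
  "encode = (\<lambda>(G, k). let n = card (verts G) in
     replicate n True @ [False]
     @ concat (map (\<lambda>i. map (\<lambda>j. {i, j} \<in> edges G) [0..<n]) [0..<n])
     @ binary k)"


section \<open>Polynomial-time algorithms\<close>

text \<open>
  The machine model is the unit-cost random access machine with addition and truncated subtraction,
  a read-only input tape and a write-only output tape (both of bits), programmed in a structured
  while-language. A program uses finitely many arrays of natural numbers, named by numbers; each has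
  unboundedly many cells, all initially zero, and cell 0 of an array may serve as a register. There is
  no multiplication: one step of a fixed program lengthens the binary representation of the largest
  number in use by at most a constant, so that this machine and the Turing machine simulate each other
  with polynomial overhead.
\<close>

datatype aexp =
    Const nat
  | Cell nat aexp    \<comment> \<open>\<open>Cell a i\<close> is the content of cell \<open>i\<close> of array \<open>a\<close>\<close>
  | Add aexp aexp
  | Sub aexp aexp

datatype bexp =
    Less aexp aexp
  | Equal aexp aexp
  | Neg bexp
  | Conj bexp bexp

datatype com =
    Skip
  | Assign nat aexp aexp    \<comment> \<open>\<open>Assign a i e\<close> stores \<open>e\<close> in cell \<open>i\<close> of array \<open>a\<close>\<close>
  | Read nat aexp           \<comment> \<open>stores the next input bit (0 or 1), or 2 at the end of the input\<close>
  | Write bexp              \<comment> \<open>appends a bit to the output\<close>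
  | Seq com com
  | Cond bexp com com
  | While bexp com

type_synonym memory = "nat \<Rightarrow> nat \<Rightarrow> nat"

fun aval :: "aexp \<Rightarrow> memory \<Rightarrow> nat" where
  "aval (Const n) m = n"
| "aval (Cell a i) m = m a (aval i m)"
| "aval (Add e f) m = aval e m + aval f m"
| "aval (Sub e f) m = aval e m - aval f m"

fun bval :: "bexp \<Rightarrow> memory \<Rightarrow> bool" where
  "bval (Less e f) m \<longleftrightarrow> aval e m < aval f m"
| "bval (Equal e f) m \<longleftrightarrow> aval e m = aval f m"
| "bval (Neg b) m \<longleftrightarrow> \<not> bval b m"
| "bval (Conj b c) m \<longleftrightarrow> bval b m \<and> bval c m"

definition store :: "memory \<Rightarrow> nat \<Rightarrow> nat \<Rightarrow> nat \<Rightarrow> memory" where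
  "store m a i v = m(a := (m a)(i := v))"

text \<open>A configuration consists of the memory, the unread input and the output written so far.\<close>

type_synonym config = "memory \<times> bool list \<times> bool list"

text \<open>\<open>exec c s t s'\<close>: started in \<open>s\<close>, \<open>c\<close> halts after \<open>t\<close> steps in \<open>s'\<close>.\<close>

inductive exec :: "com \<Rightarrow> config \<Rightarrow> nat \<Rightarrow> config \<Rightarrow> bool" where
  Skip: "exec Skip s 1 s"
| Assign: "exec (Assign a i e) (m, xs, ys) 1 (store m a (aval i m) (aval e m), xs, ys)"
| ReadBit: "exec (Read a i) (m, x # xs, ys) 1 (store m a (aval i m) (of_bool x), xs, ys)"
| ReadEnd: "exec (Read a i) (m, [], ys) 1 (store m a (aval i m) 2, [], ys)"
| Write: "exec (Write b) (m, xs, ys) 1 (m, xs, ys @ [bval b m])"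
| Seq: "exec c s t s' \<Longrightarrow> exec d s' t' s'' \<Longrightarrow> exec (Seq c d) s (t + t') s''"
| CondTrue: "bval b (fst s) \<Longrightarrow> exec c s t s' \<Longrightarrow> exec (Cond b c d) s (1 + t) s'"
| CondFalse: "\<not> bval b (fst s) \<Longrightarrow> exec d s t s' \<Longrightarrow> exec (Cond b c d) s (1 + t) s'"
| WhileFalse: "\<not> bval b (fst s) \<Longrightarrow> exec (While b c) s 1 s"
| WhileTrue: "bval b (fst s) \<Longrightarrow> exec c s t s' \<Longrightarrow> exec (While b c) s' t' s'' \<Longrightarrow>
    exec (While b c) s (1 + t + t') s''"

lemma exec_deterministic:
  assumes "exec c s t s'" and "exec c s u s''"
  shows "t = u \<and> s' = s''"
  using assms
proof (induction arbitrary: u s'' rule: exec.induct)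
  case (Skip s)
  then show ?case by cases auto
next
  case (Assign a i e m xs ys)
  then show ?case by cases auto
next
  case (ReadBit a i m x xs ys)
  then show ?case by cases auto
next
  case (ReadEnd a i m ys)
  then show ?case by cases auto
next
  case (Write b m xs ys)
  then show ?case by cases auto
next
  case (CondTrue b s c t s' d)
  from CondTrue.prems show ?case by cases (use CondTrue.IH CondTrue.hyps in blast)+
next
  case (CondFalse b s d t s' c)
  from CondFalse.prems show ?case by cases (use CondFalse.IH CondFalse.hyps in blast)+
next
  case (Seq c s t s' d t' s'')
  from Seq.prems show ?case by cases (use Seq.IH in blast)
next
  case (WhileFalse b s c)
  from WhileFalse.prems show ?case by cases (use WhileFalse.hyps in auto)
next
  case (WhileTrue b s c t s' t' s'')
  from WhileTrue.prems show ?case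
  proof cases
    case (WhileTrue v r w)
    with WhileTrue.IH show ?thesis by blast
  qed (use WhileTrue.hyps in auto)
qed

text \<open>
  The function \<open>f\<close>, on the domain \<open>D\<close> and with respect to the encoding \<open>enc\<close> of arguments and results,
  is computed by one program whose running time is polynomial in the length of the input string.
\<close>

definition poly_time_computable :: "('i \<Rightarrow> bool list) \<Rightarrow> 'i set \<Rightarrow> ('i \<Rightarrow> 'i) \<Rightarrow> bool" where
  "poly_time_computable enc D f \<longleftrightarrow>
     (\<exists>(c :: com) (p :: nat poly). \<forall>x \<in> D. \<exists>t m xs.
        exec c (\<lambda>_ _. 0, enc x, []) t (m, xs, enc (f x)) \<and> t \<le> poly p (length (enc x)))"

text \<open>The encoding of instances is injective.\<close>

lemma binary_inject: "binary k = binary l \<Longrightarrow> k = l"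
proof (induction k arbitrary: l rule: less_induct)
  case (less k)
  show ?case
  proof (cases "k = 0 \<or> l = 0")
    case True
    with less.prems show ?thesis
      by (auto simp: binary.simps[of k] binary.simps[of l] split: if_splits)
  next
    case False
    then have "binary (k div 2) = binary (l div 2)" "odd k = odd l"
      using less.prems by (auto simp: binary.simps[of k] binary.simps[of l])
    with less.IH[of "k div 2" "l div 2"] False have "k div 2 = l div 2" by simp
    with \<open>odd k = odd l\<close> show ?thesis
      by (metis div_mult_mod_eq even_iff_mod_2_eq_zero odd_iff_mod_2_eq_one)
  qed
qed

lemma encode_inj_on: "inj_on encode graph_instances"
proof (rule inj_onI)
  fix I J :: "nat graph \<times> nat"
  assume I: "I \<in> graph_instances" and J: "J \<in> graph_instances" and eq: "encode I = encode J"
  obtain n E k where I': "I = (({..<n}, E), k)" and E: "E \<subseteq> [{..<n}]\<^bsup>2\<^esup>"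
    using I by (cases I) (auto simp: graph_instances_def simple_graph_def)
  obtain n' E' k' where J': "J = (({..<n'}, E'), k')" and E': "E' \<subseteq> [{..<n'}]\<^bsup>2\<^esup>"
    using J by (cases J) (auto simp: graph_instances_def simple_graph_def)
  let ?M = "\<lambda>n E. concat (map (\<lambda>i. map (\<lambda>j. {i, j} \<in> E) [0..<n]) [0..<n])"
  have eq': "replicate n True @ False # ?M n E @ binary k
      = replicate n' True @ False # ?M n' E' @ binary k'"
    using eq by (simp add: I' J' encode_def Let_def)
  have unary: "length (takeWhile id (replicate m True @ False # ys)) = m" for m ys
    by (induction m) auto
  have n: "n' = n"
    using arg_cong[OF eq', of "\<lambda>xs. length (takeWhile id xs)"] by (simp only: unary)
  have "length (?M n E) = length (?M n E')"
    by (simp add: length_concat comp_def)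
  with eq' n have M: "?M n E = ?M n E'" and "binary k = binary k'" by auto
  then have k: "k = k'" using binary_inject by blast
  have "map (\<lambda>i. map (\<lambda>j. {i, j} \<in> E) [0..<n]) [0..<n]
      = map (\<lambda>i. map (\<lambda>j. {i, j} \<in> E') [0..<n]) [0..<n]"
    using M by (rule concat_injective) (auto simp: set_zip)
  then have adj: "{i, j} \<in> E \<longleftrightarrow> {i, j} \<in> E'" if "i < n" "j < n" for i j
    using that by (simp add: map_eq_conv)
  have "e \<in> E \<longleftrightarrow> e \<in> E'" for e
  proof (cases "e \<in> [{..<n}]\<^bsup>2\<^esup>")
    case True
    then obtain i j where "e = {i, j}" "i < n" "j < n"
      by (auto simp: nsets_def card_2_iff)
    with adj show ?thesis by blast
  next
    case False
    with E E' n show ?thesis by blast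
  qed
  with n k show "I = J" by (auto simp: I' J')
qed

end

theory Submission
  imports Defs
begin

text \<open>
  A graph is trivially perfect iff it has no \<^emph>\<open>obstruction\<close>: a path \<open>a b c d\<close> with \<open>a c\<close> and \<open>b d\<close>
  non-adjacent. Every completion must add \<open>a c\<close> or \<open>b d\<close>. If for a pair \<open>a c\<close> more than \<open>2 k\<close> pairs
  \<open>(b, d)\<close> arise, then \<open>a c\<close> is forced: add it and decrease \<open>k\<close>. Once no edge is forced, a
  yes-instance has only \<open>O(k\<^sup>2)\<close> vertices in obstructions. A vertex \<open>v\<close> in no obstruction can be deleted:
  its neighbours with neighbours outside \<open>N[v]\<close> form a clique \<open>A\<close>, the other neighbours together with
  \<open>v\<close> form a module, and from a completion of the remaining graph one can drop edges such that the rest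
  follows the nesting of neighbourhoods on \<open>A\<close> and \<open>v\<close> can be added back without new edges. Hence the
  vertices in obstructions induce a kernel, even with \<open>O(k\<^sup>2)\<close> vertices.

  For the running time it suffices that every loop of the program makes at most \<open>B\<close> iterations, where
  \<open>B\<close> is linear in the input length: then the syntactic bound \<open>time_bound B\<close>, a polynomial in \<open>B\<close> for a
  fixed program, applies.
\<close>

section \<open>Obstructions and forced edges\<close>

text \<open>Both constants come from counting ordered pairs. If \<open>{a, c}\<close> is not added,
  every partner \<open>(b, d)\<close> needs \<open>{b, d}\<close> in the solution, and
  \<open>k\<close> edges have only \<open>2 * k\<close> orderings. Conversely, once nothing is
  forced, a solution has at most \<open>2 * k\<close> ordered pairs \<open>(a, c)\<close>, each with
  at most \<open>2 * k\<close> partners and four vertices per obstruction: \<open>16 * k * k\<close>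
  in total. A larger core refutes the instance. At \<open>k = 0\<close> the rule is withheld, since
  truncated subtraction would give an edge for free; a yes-instance then has an empty core, so the
  same bound holds. The obstacle in deleting \<open>v\<close> is that a completion of the rest may
  join a vertex of \<open>N - A\<close> to one outside \<open>N[v]\<close>, or two outside vertices
  with different neighbours in \<open>A\<close>; either can create obstructions through
  \<open>v\<close>. Such edges are dropped, and what remains must still be obstruction-free. Hence
  the pruning follows the nesting that the completion itself has on \<open>A\<close>. The parameter
  is given in binary, so no loop may run \<open>k\<close> times: passes of the rule are counted by
  missing edges.\<close>

definition obstruction :: "'a set set \<Rightarrow> 'a \<Rightarrow> 'a \<Rightarrow> 'a \<Rightarrow> 'a \<Rightarrow> bool" where
  "obstruction E a b c d \<longleftrightarrow>
     {a, b} \<in> E \<and> {b, c} \<in> E \<and> {c, d} \<in> E \<and> {a, c} \<notin> E \<and> {b, d} \<notin> E \<and> a \<noteq> c \<and> b \<noteq> d"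

lemma obstruction_rev: "obstruction E a b c d \<Longrightarrow> obstruction E d c b a"
  by (auto simp: obstruction_def insert_commute)

lemma edge_in_nsets:
  assumes "E \<subseteq> [V]\<^bsup>2\<^esup>" "{x, y} \<in> E"
  shows "x \<in> V" "y \<in> V" "x \<noteq> y"
proof -
  have "{x, y} \<in> [V]\<^bsup>2\<^esup>" using assms by blast
  then show "x \<in> V" "y \<in> V" "x \<noteq> y" by (auto simp: nsets_def card_insert_if split: if_splits)
qed

lemma obstruction_verts:
  assumes "E \<subseteq> [V]\<^bsup>2\<^esup>" "obstruction E a b c d"
  shows "{a, b, c, d} \<subseteq> V"
  using assms edge_in_nsets by (fastforce simp: obstruction_def)

lemma obstruction_distinct:
  assumes "E \<subseteq> [V]\<^bsup>2\<^esup>" "obstruction E a b c d"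
  shows "distinct [a, b, c, d]"
  using assms edge_in_nsets by (fastforce simp: obstruction_def insert_commute)

text \<open>Neither \<open>P4\<close> nor \<open>C4\<close> has a vertex adjacent to the other
  three: \<open>a\<close> misses \<open>c\<close> and \<open>b\<close> misses \<open>d\<close>. So a
  vertex universal on the four rules out an obstruction.\<close>

lemma obstruction_nonneighbour:
  assumes "obstruction E a b c d" "w \<in> {a, b, c, d}"
  shows "\<exists>u \<in> {a, b, c, d}. u \<noteq> w \<and> {w, u} \<notin> E"
  using assms by (auto simp: obstruction_def insert_commute)

text \<open>The path \<open>a b c d\<close> is connected, so a set containing some but not all of
  its vertices is left along an edge.\<close>

lemma obstruction_crossing_edge:
  assumes "obstruction E a b c d" "x \<in> {a, b, c, d}" "x \<in> Z" "y \<in> {a, b, c, d}" "y \<notin> Z"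
  shows "\<exists>x \<in> {a, b, c, d} \<inter> Z. \<exists>y \<in> {a, b, c, d} - Z. {x, y} \<in> E"
proof -
  have "{a, b} \<in> E" "{b, a} \<in> E" "{b, c} \<in> E" "{c, b} \<in> E" "{c, d} \<in> E" "{d, c} \<in> E"
    using assms(1) by (auto simp: obstruction_def insert_commute)
  then show ?thesis using assms(2-) by (cases "a \<in> Z"; cases "b \<in> Z"; cases "c \<in> Z") blast+
qed

lemma nsets_2_subset_4:
  assumes "E \<subseteq> [V]\<^bsup>2\<^esup>" "e \<in> E" "e \<subseteq> {a, b, c, d}"
  shows "e \<in> {{a, b}, {a, c}, {a, d}, {b, c}, {b, d}, {c, d}}"
proof -
  obtain x y where "e = {x, y}" "x \<noteq> y"
    using assms by (auto simp: nsets_def card_2_iff dest!: subsetD)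
  then have "x \<in> {a, b, c, d}" "y \<in> {a, b, c, d}" "x \<noteq> y" using assms(3) by auto
  then show ?thesis unfolding \<open>e = {x, y}\<close>
    by (elim insertE emptyE) (simp_all add: doubleton_eq_iff)
qed

lemma trivially_perfect_iff:
  assumes E: "E \<subseteq> [V]\<^bsup>2\<^esup>"
  shows "trivially_perfect (V, E) \<longleftrightarrow> (\<forall>a b c d. \<not> obstruction E a b c d)"
proof
  assume tp: "trivially_perfect (V, E)"
  show "\<forall>a b c d. \<not> obstruction E a b c d"
  proof (intro allI notI)
    fix a b c d assume obs: "obstruction E a b c d"
    note dist = obstruction_distinct[OF E obs] and VV = obstruction_verts[OF E obs]
    let ?U = "{a, b, c, d}"
    define f :: "'a \<Rightarrow> nat" where
      "f x = (if x = a then 0 else if x = b then 1 else if x = c then 2 else 3)" for x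
    have f: "f a = 0" "f b = 1" "f c = 2" "f d = 3" using dist by (auto simp: f_def)
    have bij: "bij_betw f ?U {0, 1, 2, 3}"
      using dist f by (auto simp: bij_betw_def inj_on_def)
    \<comment> \<open>Only the pair \<open>{a, d}\<close> is left open by an obstruction; the case
      split on it below separates \<open>C4\<close> from \<open>P4\<close>.\<close>
    have ed: "{e \<in> E. e \<subseteq> ?U} = {{a, b}, {b, c}, {c, d}} \<union> (if {a, d} \<in> E then {{a, d}} else {})"
    proof -
      have "e \<in> {{a, b}, {b, c}, {c, d}} \<union> (if {a, d} \<in> E then {{a, d}} else {})"
        if "e \<in> E" "e \<subseteq> ?U" for e
        using nsets_2_subset_4[OF E that] obs that(1) unfolding obstruction_def
        by (elim insertE emptyE) simp_all
      moreover have "{{a, b}, {b, c}, {c, d}} \<union> (if {a, d} \<in> E then {{a, d}} else {}) \<subseteq> {e \<in> E. e \<subseteq> ?U}"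
        using obs by (simp add: obstruction_def)
      ultimately show ?thesis by blast
    qed
    have "contains_induced (V, E) C4 \<or> contains_induced (V, E) P4"
    proof (cases "{a, d} \<in> E")
      case True
      then have "isomorphic (induced_subgraph (V, E) ?U) C4"
        unfolding isomorphic_def induced_subgraph_def C4_def
        using bij f by (intro exI[of _ f]) (auto simp: ed insert_commute)
      with VV show ?thesis by (auto simp: contains_induced_def)
    next
      case False
      then have "isomorphic (induced_subgraph (V, E) ?U) P4"
        unfolding isomorphic_def induced_subgraph_def P4_def
        using bij f by (intro exI[of _ f]) (auto simp: ed insert_commute)
      with VV show ?thesis by (auto simp: contains_induced_def)
    qed
    with tp show False by (auto simp: trivially_perfect_def)
  qed
next
  assume no: "\<forall>a b c d. \<not> obstruction E a b c d"
  \<comment> \<open>One argument serves both graphs: only the path \<open>0 1 2 3\<close> and the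
    missing pairs \<open>{0, 2}\<close> and \<open>{1, 3}\<close> of \<open>K\<close> enter.\<close>
  have *: False if ci: "contains_induced (V, E) (K :: nat graph)"
    and K: "verts K = {0, 1, 2, 3}" "{0, 1} \<in> edges K" "{1, 2} \<in> edges K" "{2, 3} \<in> edges K"
      "{0, 2} \<notin> edges K" "{1, 3} \<notin> edges K" for K
  proof -
    obtain U f where U: "U \<subseteq> V" and bij: "bij_betw f U {0, 1, 2, 3::nat}"
      and ed: "edges K = (\<lambda>e. f ` e) ` {e \<in> E. e \<subseteq> U}"
      using ci K(1) by (auto simp: contains_induced_def isomorphic_def induced_subgraph_def)
    obtain g where g: "\<And>i. i \<in> {0, 1, 2, 3} \<Longrightarrow> g i \<in> U \<and> f (g i) = i"
      using bij by (metis bij_betw_def f_inv_into_f inv_into_into)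
    have gf: "g (f x) = x" if "x \<in> U" for x
      using that bij g by (metis bij_betwE bij_betw_def inj_onD)
    have edge: "{g i, g j} \<in> E \<longleftrightarrow> {i, j} \<in> edges K"
      if "i \<in> {0, 1, 2, 3}" "j \<in> {0, 1, 2, 3}" for i j
    proof
      assume "{g i, g j} \<in> E"
      then have "f ` {g i, g j} \<in> edges K" unfolding ed using g[OF that(1)] g[OF that(2)] by blast
      then show "{i, j} \<in> edges K" using g[OF that(1)] g[OF that(2)] by simp
    next
      assume "{i, j} \<in> edges K"
      then obtain e where e: "e \<in> E" "e \<subseteq> U" "f ` e = {i, j}" unfolding ed by auto
      have "g ` f ` e = e" using e(2) gf by (force simp: image_image)
      with e show "{g i, g j} \<in> E" by simp
    qed
    have "g 0 \<noteq> g 2" "g 1 \<noteq> g 3"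
      using g[of 0] g[of 1] g[of 2] g[of 3] by auto
    then have "obstruction E (g 0) (g 1) (g 2) (g 3)"
      using K by (simp add: obstruction_def edge)
    with no show False by blast
  qed
  have "\<not> contains_induced (V, E) C4"
    using *[of C4] by (auto simp: C4_def doubleton_eq_iff)
  moreover have "\<not> contains_induced (V, E) P4"
    using *[of P4] by (auto simp: P4_def doubleton_eq_iff)
  ultimately show "trivially_perfect (V, E)" by (simp add: trivially_perfect_def)
qed

lemma TPC_iff:
  assumes E: "E \<subseteq> [V]\<^bsup>2\<^esup>"
  shows "TPC (V, E) k \<longleftrightarrow>
    (\<exists>S \<subseteq> [V]\<^bsup>2\<^esup> - E. card S \<le> k \<and> (\<forall>a b c d. \<not> obstruction (E \<union> S) a b c d))"
proof -
  have *: "trivially_perfect (V, E \<union> S) \<longleftrightarrow> (\<forall>a b c d. \<not> obstruction (E \<union> S) a b c d)"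
    if "S \<subseteq> [V]\<^bsup>2\<^esup> - E" for S
    using E that by (intro trivially_perfect_iff) auto
  show ?thesis unfolding TPC_def fst_conv snd_conv by (intro ex_cong1 conj_cong refl *)
qed

section \<open>The forced-edge rule\<close>

lemma obstruction_hit:
  assumes "obstruction E a b c d" "\<not> obstruction (E \<union> S) a b c d"
  shows "{a, c} \<in> S \<or> {b, d} \<in> S"
  using assms unfolding obstruction_def by blast

lemma card_ordered_pairs_le:
  assumes "finite S"
  shows "finite {(x, y). x \<noteq> y \<and> {x, y} \<in> S}"
    and "card {(x, y). x \<noteq> y \<and> {x, y} \<in> S} \<le> 2 * card S"
proof -
  let ?P = "\<lambda>e. {(x, y). x \<noteq> y \<and> {x, y} = e}"
  have P: "finite (?P e) \<and> card (?P e) \<le> 2" for e :: "'a set"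
  proof (cases "\<exists>x y. x \<noteq> y \<and> e = {x, y}")
    case True
    then obtain x y where "x \<noteq> y" "e = {x, y}" by blast
    then have "?P e = {(x, y), (y, x)}" unfolding \<open>e = {x, y}\<close> doubleton_eq_iff by fast
    moreover have "finite {(x, y), (y, x)} \<and> card {(x, y), (y, x)} \<le> 2" using \<open>x \<noteq> y\<close> by simp
    ultimately show ?thesis by (rule ssubst)
  next
    case False
    then have "?P e = {}" by blast
    then show ?thesis by (metis card.empty finite.emptyI zero_le)
  qed
  have eq: "{(x, y). x \<noteq> y \<and> {x, y} \<in> S} = (\<Union>e\<in>S. ?P e)" by blast
  show "finite {(x, y). x \<noteq> y \<and> {x, y} \<in> S}" unfolding eq using assms P by blast
  have "card (\<Union>e\<in>S. ?P e) \<le> (\<Sum>e\<in>S. card (?P e))" by (rule card_UN_le[OF assms])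
  also have "\<dots> \<le> (\<Sum>e\<in>S. 2)" by (rule sum_mono) (use P in blast)
  finally show "card {(x, y). x \<noteq> y \<and> {x, y} \<in> S} \<le> 2 * card S" unfolding eq by simp
qed

text \<open>The pairs are ordered because the program counts them with two nested loops. In an
  induced \<open>C4\<close> both \<open>(b, d)\<close> and \<open>(d, b)\<close> count.\<close>

definition partners :: "'a set set \<Rightarrow> 'a \<Rightarrow> 'a \<Rightarrow> ('a \<times> 'a) set" where
  "partners E a c = {(b, d). obstruction E a b c d}"

lemma finite_partners:
  assumes "finite V" "E \<subseteq> [V]\<^bsup>2\<^esup>"
  shows "finite (partners E a c)"
  by (rule finite_subset[of _ "V \<times> V"])
    (use obstruction_verts[OF assms(2)] assms(1) in \<open>auto simp: partners_def\<close>)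

lemma TPC_insert_forced:
  assumes V: "finite V" and E: "E \<subseteq> [V]\<^bsup>2\<^esup>" and many: "2 * k < card (partners E a c)"
    and k: "0 < k"
  shows "TPC (V, E) k \<longleftrightarrow> TPC (V, insert {a, c} E) (k - 1)"
proof -
  have "partners E a c \<noteq> {}" using many by auto
  then obtain b d where bd: "obstruction E a b c d" by (auto simp: partners_def)
  have ac: "{a, c} \<in> [V]\<^bsup>2\<^esup> - E"
    using bd obstruction_verts[OF E bd] by (auto simp: obstruction_def nsets_def)
  then have E': "insert {a, c} E \<subseteq> [V]\<^bsup>2\<^esup>" using E by simp
  have fin: "finite S" if "S \<subseteq> [V]\<^bsup>2\<^esup> - F" for S F
    using that V finite_imp_finite_nsets by (metis finite_Diff finite_subset)
  show ?thesis
  proof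
    assume "TPC (V, E) k"
    then obtain S where S: "S \<subseteq> [V]\<^bsup>2\<^esup> - E" "card S \<le> k"
      and no: "\<And>a b c d. \<not> obstruction (E \<union> S) a b c d"
      unfolding TPC_iff[OF E] by blast
    note finS = fin[OF S(1)]
    have "{a, c} \<in> S"
    proof (rule ccontr)
      assume "{a, c} \<notin> S"
      then have "b \<noteq> d \<and> {b, d} \<in> S" if "obstruction E a b c d" for b d
        using obstruction_hit[OF that no] that by (simp add: obstruction_def)
      then have "partners E a c \<subseteq> {(x, y). x \<noteq> y \<and> {x, y} \<in> S}"
        unfolding partners_def by blast
      then have "card (partners E a c) \<le> 2 * card S"
        by (rule order_trans[OF card_mono[OF card_ordered_pairs_le(1)[OF finS]] card_ordered_pairs_le(2)[OF finS]])
      with many S show False by simp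
    qed
    then have "insert {a, c} E \<union> (S - {{a, c}}) = E \<union> S" by blast
    moreover have "card (S - {{a, c}}) \<le> k - 1" using \<open>{a, c} \<in> S\<close> S(2) finS by simp
    moreover have "S - {{a, c}} \<subseteq> [V]\<^bsup>2\<^esup> - insert {a, c} E" using S(1) by blast
    ultimately show "TPC (V, insert {a, c} E) (k - 1)"
      unfolding TPC_iff[OF E'] using no by (intro exI[of _ "S - {{a, c}}"]) simp
  next
    assume "TPC (V, insert {a, c} E) (k - 1)"
    then obtain S where S: "S \<subseteq> [V]\<^bsup>2\<^esup> - insert {a, c} E" "card S \<le> k - 1"
      and no: "\<And>x y z w. \<not> obstruction (insert {a, c} E \<union> S) x y z w"
      unfolding TPC_iff[OF E'] by blast
    have "card (insert {a, c} S) \<le> k" using S(2) k fin[OF S(1)] by (auto simp: card_insert_if)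
    moreover have "insert {a, c} S \<subseteq> [V]\<^bsup>2\<^esup> - E" using S ac by blast
    ultimately show "TPC (V, E) k"
      unfolding TPC_iff[OF E] using no by (intro exI[of _ "insert {a, c} S"]) simp
  qed
qed

section \<open>The vertices in obstructions and their number\<close>

definition core :: "'a set set \<Rightarrow> 'a set" where
  "core E = {v. \<exists>a b c d. obstruction E a b c d \<and> v \<in> {a, b, c, d}}"

text \<open>Reversal turns the last two positions into the first two. The program can therefore test
  \<open>v\<close> as first or second vertex only.\<close>

lemma core_iff: "v \<in> core E \<longleftrightarrow> (\<exists>b c d. obstruction E v b c d \<or> obstruction E b v c d)"
proof
  assume "v \<in> core E"
  then obtain a b c d where "obstruction E a b c d" "v = a \<or> v = b \<or> v = c \<or> v = d"
    by (auto simp: core_def)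
  then show "\<exists>b c d. obstruction E v b c d \<or> obstruction E b v c d"
    using obstruction_rev[of E a b c d] by metis
next
  assume "\<exists>b c d. obstruction E v b c d \<or> obstruction E b v c d"
  then show "v \<in> core E" unfolding core_def by blast
qed

lemma core_subset: "E \<subseteq> [V]\<^bsup>2\<^esup> \<Longrightarrow> core E \<subseteq> V"
  unfolding core_def by (blast dest: obstruction_verts)

lemma card_core_le:
  assumes V: "finite V" and E: "E \<subseteq> [V]\<^bsup>2\<^esup>" and tpc: "TPC (V, E) k"
    and few: "k = 0 \<or> (\<forall>a c. card (partners E a c) \<le> 2 * k)"
  shows "card (core E) \<le> 16 * (k * k)"
proof -
  obtain S where S: "S \<subseteq> [V]\<^bsup>2\<^esup> - E" "card S \<le> k"
    and no: "\<And>a b c d. \<not> obstruction (E \<union> S) a b c d"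
    using tpc unfolding TPC_iff[OF E] by blast
  have finS: "finite S"
    using S(1) V finite_imp_finite_nsets by (metis finite_Diff finite_subset)
  let ?P = "{(x, y). x \<noteq> y \<and> {x, y} \<in> S}"
  let ?W = "\<lambda>(a, c). \<Union>(b, d) \<in> partners E a c. {a, b, c, d}"
  have sub: "core E \<subseteq> (\<Union>p \<in> ?P. ?W p)"
  proof
    fix v assume "v \<in> core E"
    then obtain a b c d where o: "obstruction E a b c d" "v \<in> {a, b, c, d}"
      by (auto simp: core_def)
    from obstruction_hit[OF o(1) no] show "v \<in> (\<Union>p \<in> ?P. ?W p)"
    proof
      assume "{a, c} \<in> S"
      moreover have "a \<noteq> c" using o by (simp add: obstruction_def)
      ultimately show ?thesis using o by (force simp: partners_def)
    next
      assume "{b, d} \<in> S"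
      \<comment> \<open>Read backwards, \<open>d c b a\<close> is an obstruction whose first
        diagonal is the added one.\<close>
      then have "(d, b) \<in> ?P" using o by (auto simp: obstruction_def insert_commute)
      moreover have "v \<in> ?W (d, b)" using obstruction_rev[OF o(1)] o(2) by (force simp: partners_def)
      ultimately show ?thesis by (rule UN_I)
    qed
  qed
  show ?thesis
  proof (cases "k = 0")
    case True
    \<comment> \<open>Here \<open>S\<close> is empty, hence so is the union covering the
      core.\<close>
    then show ?thesis using sub S(2) finS by simp
  next
    case False
    have W: "finite (?W p) \<and> card (?W p) \<le> 8 * k" for p
    proof (cases p)
      case (Pair a c)
      let ?F = "\<lambda>(b, d). {a, b, c, d}"
      have "card (\<Union>q \<in> partners E a c. ?F q) \<le> (\<Sum>q \<in> partners E a c. card (?F q))"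
        by (rule card_UN_le[OF finite_partners[OF V E]])
      also have "\<dots> \<le> (\<Sum>q \<in> partners E a c. 4)"
        by (rule sum_mono) (auto simp: card_insert_if)
      also have "\<dots> \<le> 8 * k" using few False by simp
      finally show ?thesis using finite_partners[OF V E] by (auto simp: Pair)
    qed
    have "card (core E) \<le> card (\<Union>p \<in> ?P. ?W p)"
      by (rule card_mono[OF _ sub]) (use W card_ordered_pairs_le(1)[OF finS] in blast)
    also have "\<dots> \<le> (\<Sum>p \<in> ?P. card (?W p))" by (rule card_UN_le[OF card_ordered_pairs_le(1)[OF finS]])
    also have "\<dots> \<le> (\<Sum>p \<in> ?P. 8 * k)" by (rule sum_mono) (use W in blast)
    also have "\<dots> = card ?P * (8 * k)" by simp
    also have "\<dots> \<le> 2 * k * (8 * k)"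
      by (intro mult_right_mono) (use card_ordered_pairs_le(2)[OF finS] S(2) in auto)
    finally show ?thesis by simp
  qed
qed

section \<open>Induced subgraphs\<close>

definition restrict_edges :: "'a set set \<Rightarrow> 'a set \<Rightarrow> 'a set set" where
  "restrict_edges E U = {e \<in> E. e \<subseteq> U}"

lemma restrict_edges_nsets: "E \<subseteq> [V]\<^bsup>2\<^esup> \<Longrightarrow> restrict_edges E U \<subseteq> [U]\<^bsup>2\<^esup>"
  by (auto simp: restrict_edges_def nsets_def)

text \<open>Each of the four vertices lies on an edge of the restriction and hence in
  \<open>U\<close>, so the two missing pairs are missing in \<open>E\<close> as well.\<close>

lemma obstruction_restrict:
  assumes "obstruction (restrict_edges E U) a b c d"
  shows "obstruction E a b c d"
  using assms by (auto simp: obstruction_def restrict_edges_def)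

lemma TPC_restrict:
  assumes V: "finite V" and E: "E \<subseteq> [V]\<^bsup>2\<^esup>" and tpc: "TPC (V, E) k"
  shows "TPC (U, restrict_edges E U) k"
proof -
  obtain S where S: "S \<subseteq> [V]\<^bsup>2\<^esup> - E" "card S \<le> k"
    and no: "\<And>a b c d. \<not> obstruction (E \<union> S) a b c d"
    using tpc unfolding TPC_iff[OF E] by blast
  have finS: "finite S"
    using S(1) V finite_imp_finite_nsets by (metis finite_Diff finite_subset)
  have "restrict_edges E U \<union> restrict_edges S U = restrict_edges (E \<union> S) U"
    by (auto simp: restrict_edges_def)
  moreover have "card (restrict_edges S U) \<le> k"
    using S(2) card_mono[OF finS, of "restrict_edges S U"] by (auto simp: restrict_edges_def)
  moreover have "restrict_edges S U \<subseteq> [U]\<^bsup>2\<^esup> - restrict_edges E U"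
    using S(1) by (auto simp: restrict_edges_def nsets_def)
  ultimately show ?thesis
    unfolding TPC_iff[OF restrict_edges_nsets[OF E]]
    using no obstruction_restrict by (intro exI[of _ "restrict_edges S U"]) (auto dest: obstruction_restrict)
qed

section \<open>Vertices outside all obstructions\<close>

text \<open>Applied to the nesting of closed neighbourhoods on \<open>A\<close>. Totality and
  transitivity are assumed on \<open>A\<close> only, and twins make the relation a preorder rather
  than an order.\<close>

lemma total_preorder_max:
  assumes "finite F" "F \<noteq> {}" "F \<subseteq> A"
    and total: "\<And>x y. x \<in> A \<Longrightarrow> y \<in> A \<Longrightarrow> le x y \<or> le y x"
    and trans: "\<And>x y z. x \<in> A \<Longrightarrow> y \<in> A \<Longrightarrow> z \<in> A \<Longrightarrow> le x y \<Longrightarrow> le y z \<Longrightarrow> le x z"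
  shows "\<exists>p \<in> F. \<forall>x \<in> F. le x p"
  using assms(1-3)
proof (induction F rule: finite_ne_induct)
  case (singleton x)
  then show ?case using total[of x x] by auto
next
  case (insert x F)
  then obtain p where p: "p \<in> F" "\<forall>y \<in> F. le y p" by auto
  show ?case
  proof (cases "le x p")
    case True
    then show ?thesis using p by auto
  next
    case False
    then have "le p x" using total p(1) insert.prems by auto
    then have "\<forall>y \<in> F. le y x" using p insert.prems trans[of _ p x] by auto
    moreover have "le x x" using total[of x x] insert.prems by auto
    ultimately show ?thesis by auto
  qed
qed

text \<open>\<open>V\<close> splits into \<open>v\<close>, \<open>A\<close>, \<open>N - A\<close>
  and \<open>Q\<close>. The pruned graph \<open>F\<close> has no edge between \<open>N - A\<close>
  and \<open>Q\<close>, joins vertices of \<open>Q\<close> only if they have the same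
  \<open>T\<close>, and joins \<open>p\<close> in \<open>A\<close> to \<open>q\<close> in
  \<open>Q\<close> iff \<open>p\<close> is in \<open>T q\<close>. In an obstruction meeting
  \<open>A\<close>, the largest of its vertices in \<open>A\<close> would be adjacent to all others.
  One avoiding \<open>A\<close> is connected, so it lies in a single class of \<open>Q\<close> or in
  \<open>N - A\<close> together with \<open>v\<close>. If it contains \<open>v\<close>, then
  \<open>v\<close> is universal; otherwise \<open>F\<close> and the obstruction-free
  \<open>H\<close> agree on it.\<close>

lemma TPC_add_irrelevant:
  assumes V: "finite V" and E: "E \<subseteq> [V]\<^bsup>2\<^esup>" and v: "v \<in> V" "v \<notin> core E"
    and tpc: "TPC (V - {v}, restrict_edges E (V - {v})) k"
  shows "TPC (V, E) k"
proof -
  let ?E' = "restrict_edges E (V - {v})"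
  note E' = restrict_edges_nsets[OF E, of "V - {v}"]
  obtain S where S: "S \<subseteq> [V - {v}]\<^bsup>2\<^esup> - ?E'" "card S \<le> k"
    and no: "\<And>a b c d. \<not> obstruction (?E' \<union> S) a b c d"
    using tpc unfolding TPC_iff[OF E'] by blast
  have finS: "finite S"
    using S(1) V finite_imp_finite_nsets by (metis finite_Diff finite_subset)
  txt \<open>
    \<open>le\<close> is the nesting of the closed neighbourhoods in the completion \<open>H\<close>. \<open>T q\<close> collects the vertices of
    \<open>A\<close> that must be adjacent to \<open>q\<close> if \<open>H\<close> is to follow this nesting; these sets form a chain, and
    connected vertices outside \<open>N[v]\<close> have the same one. The edges of \<open>S\<close> that are not \<open>good\<close> are dropped.
  \<close>
  define H where "H = ?E' \<union> S"
  define N where "N = {x. {v, x} \<in> E}"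
  define A where "A = {p \<in> N. \<exists>q. {p, q} \<in> E \<and> q \<notin> N \<and> q \<noteq> v}"
  define Q where "Q = V - N - {v}"
  define le where "le p p' \<longleftrightarrow> (\<forall>x. {p, x} \<in> H \<longrightarrow> x = p' \<or> {p', x} \<in> H)" for p p'
  define T where "T q = {p \<in> A. \<exists>p' \<in> A. le p' p \<and> {p', q} \<in> E}" for q
  define good where "good e \<longleftrightarrow> (\<exists>x y. e = {x, y} \<and>
      (x \<in> N - A \<and> y \<in> N - A \<or> x \<in> Q \<and> y \<in> Q \<and> T x = T y \<or> x \<in> A \<and> y \<in> Q \<and> x \<in> T y))" for e
  define F where "F = E \<union> {e \<in> S. good e}"
  have nv: "\<not> obstruction E a b c d" if "v \<in> {a, b, c, d}" for a b c d
    using v(2) that unfolding core_def by blast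
  have AN: "A \<subseteq> N" and NV: "N \<subseteq> V" and vN: "v \<notin> N"
    using edge_in_nsets(2)[OF E] edge_in_nsets(3)[OF E, of v v] by (auto simp: A_def N_def)
  have vQ: "v \<notin> Q" and QN: "Q \<inter> N = {}" by (auto simp: Q_def)
  have EH: "{x, y} \<in> H" if "{x, y} \<in> E" "x \<noteq> v" "y \<noteq> v" for x y
    using that edge_in_nsets[OF E that(1)] by (simp add: H_def restrict_edges_def)
  have HE: "{x, y} \<in> E \<or> {x, y} \<in> S" if "{x, y} \<in> H" for x y
    using that by (auto simp: H_def restrict_edges_def)
  have Sv: "x \<noteq> v \<and> y \<noteq> v \<and> x \<in> V \<and> y \<in> V" if "{x, y} \<in> S" for x y
    using that S(1) edge_in_nsets[of S "V - {v}" x y] by blast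
  \<comment> \<open>\<open>A\<close> is complete to all of \<open>N\<close>: otherwise
    \<open>q p v x\<close> is an obstruction through \<open>v\<close>.\<close>
  have clique: "{p, x} \<in> E" if "p \<in> A" "x \<in> N" "x \<noteq> p" for p x
  proof (rule ccontr)
    assume px: "{p, x} \<notin> E"
    obtain q where q: "{p, q} \<in> E" "q \<notin> N" "q \<noteq> v" "p \<in> N" using \<open>p \<in> A\<close> by (auto simp: A_def)
    then have "obstruction E q p v x"
      using px that unfolding obstruction_def N_def by (auto simp: insert_commute)
    with nv show False by blast
  qed
  have cliqueH: "{p, x} \<in> H" if "p \<in> A" "x \<in> N" "x \<noteq> p" for p x
    using EH[OF clique[OF that]] that AN vN by blast
  \<comment> \<open>\<open>p\<close> and \<open>p'\<close> are adjacent, so private neighbours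
    \<open>x\<close> and \<open>y\<close> would make \<open>x p p' y\<close> an obstruction of
    \<open>H\<close>.\<close>
  have total: "le p p' \<or> le p' p" if "p \<in> A" "p' \<in> A" for p p'
  proof (rule ccontr)
    assume "\<not> ?thesis"
    then obtain x y where x: "{p, x} \<in> H" "x \<noteq> p'" "{p', x} \<notin> H"
      and y: "{p', y} \<in> H" "y \<noteq> p" "{p, y} \<notin> H" by (auto simp: le_def)
    have "p \<noteq> p'" using x by auto
    then have "{p, p'} \<in> H" using cliqueH that AN by blast
    then have "obstruction H x p p' y"
      using x y unfolding obstruction_def by (simp add: insert_commute)
    with no show False by (simp add: H_def)
  qed
  have trans: "le p q" if "p \<in> A" "p' \<in> A" "q \<in> A" "le p p'" "le p' q" for p p' q
    unfolding le_def
  proof (intro allI impI)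
    fix x assume "{p, x} \<in> H"
    then have "x = p' \<or> {p', x} \<in> H" using that(4) by (auto simp: le_def)
    \<comment> \<open>The exceptional case \<open>x = p'\<close> is settled by the edge between
      \<open>q\<close> and \<open>p'\<close> in the clique.\<close>
    then show "x = q \<or> {q, x} \<in> H"
      using cliqueH[of q p'] that AN by (auto simp: le_def)
  qed
  have T_mono: "p' \<in> T q" if "p \<in> T q" "le p p'" "p' \<in> A" for p p' q
    using that trans unfolding T_def by blast
  have T_E: "p \<in> T q" if "p \<in> A" "{p, q} \<in> E" for p q
    using that total[of p p] unfolding T_def by blast
  have F_cases: "{x, y} \<in> E \<or> {x, y} \<in> S \<and> (x \<in> N - A \<and> y \<in> N - A \<or> x \<in> Q \<and> y \<in> Q \<and> T x = T y
      \<or> x \<in> A \<and> y \<in> Q \<and> x \<in> T y \<or> y \<in> A \<and> x \<in> Q \<and> y \<in> T x)" if "{x, y} \<in> F" for x y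
    using that unfolding F_def good_def by (auto simp: doubleton_eq_iff)
  have FI: "{x, y} \<in> F" if "{x, y} \<in> H" "x \<in> N - A \<and> y \<in> N - A \<or> x \<in> Q \<and> y \<in> Q \<and> T x = T y
      \<or> x \<in> A \<and> y \<in> Q \<and> x \<in> T y" for x y
    using that HE[OF that(1)] unfolding F_def good_def by blast
  have FH: "{x, y} \<in> H" if "{x, y} \<in> F" "x \<noteq> v" "y \<noteq> v" for x y
    using that EH unfolding F_def H_def by blast
  have F_v: "x \<in> N" if "{v, x} \<in> F" for x
    using F_cases[OF that] Sv[of v x] by (auto simp: N_def)
  \<comment> \<open>An original edge from \<open>N\<close> to \<open>Q\<close> puts its end in
    \<open>A\<close> by definition, and no edge of \<open>S\<close> between \<open>N - A\<close> and
    \<open>Q\<close> is good.\<close>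
  have F_BQ: "{x, y} \<notin> F" if "x \<in> N - A" "y \<in> Q" for x y
  proof
    assume "{x, y} \<in> F"
    then have "{x, y} \<in> E" using F_cases that QN AN by blast
    then have "x \<in> A" using that unfolding A_def Q_def by blast
    with that show False by blast
  qed
  have F_QQ: "T q = T r" if "q \<in> Q" "r \<in> Q" "{q, r} \<in> F" for q r
  proof (cases "{q, r} \<in> E")
    case False
    then show ?thesis using F_cases[OF that(3)] that QN AN by blast
  next
    case True
    \<comment> \<open>Vertices of \<open>Q\<close> joined in \<open>E\<close> have the same
      neighbours in \<open>A\<close>, because otherwise \<open>v p q r\<close> is an obstruction
      through \<open>v\<close>. Hence they have the same \<open>T\<close>.\<close>
    have "{p, r} \<in> E" if "{q, r} \<in> E" "q \<in> Q" "r \<in> Q" "p \<in> A" "{p, q} \<in> E" for p q r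
    proof (rule ccontr)
      assume "{p, r} \<notin> E"
      moreover have "{v, p} \<in> E" "{v, q} \<notin> E" "v \<noteq> q" "p \<noteq> r"
        using that AN QN vQ by (auto simp: N_def Q_def)
      ultimately have "obstruction E v p q r" using that by (simp add: obstruction_def)
      with nv show False by blast
    qed
    from this[OF True that(1,2)] this[OF _ that(2,1)] True show ?thesis
      unfolding T_def by (auto simp: insert_commute)
  qed
  \<comment> \<open>Some \<open>p'\<close> below \<open>p\<close> is adjacent to \<open>q\<close>,
    and in \<open>H\<close> the vertex \<open>p\<close> inherits the neighbours of
    \<open>p'\<close>. The resulting edge is good, so it survives.\<close>
  have F_AQ: "{p, q} \<in> F" if pT: "p \<in> T q" and "q \<in> Q" for p q
  proof -
    obtain p' where p': "p' \<in> A" "le p' p" "{p', q} \<in> E" "p \<in> A" using pT by (auto simp: T_def)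
    have "{p', q} \<in> H" using EH p' AN vN that(2) vQ by blast
    then have "{p, q} \<in> H" using p' that(2) AN QN by (auto simp: le_def)
    then show ?thesis using FI that p'(4) by blast
  qed
  have AQ_T: "p \<in> T q" if "p \<in> A" "q \<in> Q" "{p, q} \<in> F" for p q
    using F_cases[OF that(3)] T_E that QN AN by blast
  have FV: "F \<subseteq> [V]\<^bsup>2\<^esup>" using E S(1) nsets_mono[of "V - {v}" V] unfolding F_def by blast
  have "\<not> obstruction F a b c d" for a b c d
  proof
    assume obs: "obstruction F a b c d"
    let ?W = "{a, b, c, d}"
    have WV: "?W \<subseteq> V" by (rule obstruction_verts[OF FV obs])
    have types: "w = v \<or> w \<in> A \<or> w \<in> N - A \<or> w \<in> Q" if "w \<in> ?W" for w
      using that WV by (auto simp: Q_def)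
    note crossing = obstruction_crossing_edge[OF obs]
    have not_universal: "\<exists>w \<in> ?W. w \<noteq> p \<and> {p, w} \<notin> F" if "p \<in> ?W" for p
      by (rule obstruction_nonneighbour[OF obs that])
    \<comment> \<open>An edge of \<open>F\<close> leaving a class of \<open>Q\<close> cannot end in
      \<open>v\<close>, in \<open>N - A\<close> or in another class, so it ends in
      \<open>A\<close>.\<close>
    have Q_class: "\<exists>y \<in> ?W. y \<in> A \<and> y \<in> T w"
      if w: "w \<in> ?W" "w \<in> Q" and u: "u \<in> ?W" "u \<notin> {x \<in> Q. T x = T w}" for w u
    proof -
      have wZ: "w \<in> {x \<in> Q. T x = T w}" using w by simp
      obtain x y where x: "x \<in> ?W" "x \<in> Q" "T x = T w" and y: "y \<in> ?W" "\<not> (y \<in> Q \<and> T y = T w)"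
        and xy: "{x, y} \<in> F" using crossing[OF w(1) wZ u] by blast
      have yx: "{y, x} \<in> F" using xy by (simp add: insert_commute)
      have "y \<noteq> v" using F_v[of x] yx x(2) QN by blast
      moreover have "y \<notin> N - A" using F_BQ[of y x] yx x(2) by blast
      moreover have "y \<notin> Q" using F_QQ[OF x(2) _ xy] x y by auto
      ultimately have "y \<in> A" using types[OF y(1)] by blast
      then show ?thesis using AQ_T[OF _ x(2) yx] x(3) y(1) by auto
    qed
    show False
    proof (cases "?W \<inter> A = {}")
      case False
      have "\<exists>p \<in> ?W \<inter> A. \<forall>x \<in> ?W \<inter> A. le x p"
        by (rule total_preorder_max[OF _ False _ total]) (simp_all add: trans, rule trans)
      then obtain p where p: "p \<in> ?W \<inter> A" and max: "\<forall>x \<in> ?W \<inter> A. le x p" by (elim bexE)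
      \<comment> \<open>\<open>p\<close> is universal. The case \<open>w\<close> in \<open>Q\<close>
        uses that \<open>T w\<close> is closed upwards under \<open>le\<close>: it contains the
        largest vertex \<open>p\<close> once it contains any vertex of
        \<open>?W \<inter> A\<close>.\<close>
      have "{p, w} \<in> F" if w: "w \<in> ?W" "w \<noteq> p" for w
      proof -
        consider "w = v" | "w \<in> N" | "w \<in> Q" using types[OF w(1)] AN by blast
        then show ?thesis
        proof cases
          case 1
          then show ?thesis using p AN by (auto simp: F_def N_def insert_commute)
        next
          case 2
          then show ?thesis using clique[of p w] p w by (auto simp: F_def)
        next
          case 3
          have "p \<notin> {x \<in> Q. T x = T w}" using p AN QN by blast
          then obtain y where "y \<in> ?W" "y \<in> A" "y \<in> T w" using Q_class[OF w(1) 3, of p] p by blast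
          then have "p \<in> T w" using T_mono[of y w p] p max by blast
          then show ?thesis using F_AQ 3 by blast
        qed
      qed
      with not_universal[of p] p show False by blast
    next
      case True
      have noA: "w \<notin> A" if "w \<in> ?W" for w using True that by blast
      show False
      proof (cases "\<exists>w \<in> ?W. w \<notin> Q")
        case True
        then obtain w where w: "w \<in> ?W" "w \<notin> Q" by blast
        have WB: "u \<in> insert v (N - A)" if u: "u \<in> ?W" for u
        proof (rule ccontr)
          assume "u \<notin> insert v (N - A)"
          then have "u \<in> Q" using types[OF u] noA[OF u] by blast
          then show False using Q_class[OF u _ w(1)] w(2) noA by blast
        qed
        show False
        proof (cases "v \<in> ?W")
          case True
          have "{v, u} \<in> F" if "u \<in> ?W" "u \<noteq> v" for u
            using WB[OF that(1)] that(2) by (auto simp: F_def N_def)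
          then show False using not_universal[OF True] by blast
        next
          case False
          have eq: "{x, y} \<in> H \<longleftrightarrow> {x, y} \<in> F" if "x \<in> ?W" "y \<in> ?W" for x y
            using WB[OF that(1)] WB[OF that(2)] FI[of x y] FH[of x y] that False by blast
          have "obstruction H a b c d"
            using obs unfolding obstruction_def by (simp add: eq)
          with no show False by (simp add: H_def)
        qed
      next
        case False
        then have WQ: "w \<in> Q" if "w \<in> ?W" for w using that by blast
        have Ta: "T w = T a" if "w \<in> ?W" for w
          using Q_class[of a w] WQ[of a] that noA by blast
        have eq: "{x, y} \<in> H \<longleftrightarrow> {x, y} \<in> F" if "x \<in> ?W" "y \<in> ?W" for x y
          using WQ[OF that(1)] WQ[OF that(2)] Ta[OF that(1)] Ta[OF that(2)] FI[of x y] FH[of x y] vQ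
          by auto
        have "obstruction H a b c d"
          using obs unfolding obstruction_def by (simp add: eq)
        with no show False by (simp add: H_def)
      qed
    qed
  qed
  moreover have "F = E \<union> {e \<in> S. good e \<and> e \<notin> E}" by (auto simp: F_def)
  moreover have "{e \<in> S. good e \<and> e \<notin> E} \<subseteq> [V]\<^bsup>2\<^esup> - E"
    using S(1) nsets_mono[of "V - {v}" V] by blast
  moreover have "card {e \<in> S. good e \<and> e \<notin> E} \<le> k"
    using card_mono[OF finS, of "{e \<in> S. good e \<and> e \<notin> E}"] S(2) by auto
  ultimately show ?thesis
    unfolding TPC_iff[OF E] by (intro exI[of _ "{e \<in> S. good e \<and> e \<notin> E}"]) simp
qed

section \<open>Deleting everything outside the core\<close>

lemma core_restrict_subset: "core (restrict_edges E U) \<subseteq> core E"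
  unfolding core_def by (blast dest: obstruction_restrict)

text \<open>The vertices outside the core are put back one at a time. At each stage the new vertex
  lies outside the core of the current induced subgraph, since obstructions of an induced subgraph
  are obstructions of \<open>E\<close>.\<close>

lemma TPC_restrict_core:
  assumes V: "finite V" and E: "E \<subseteq> [V]\<^bsup>2\<^esup>"
  shows "TPC (V, E) k \<longleftrightarrow> TPC (core E, restrict_edges E (core E)) k"
proof
  assume tpc: "TPC (core E, restrict_edges E (core E)) k"
  have "TPC (core E \<union> D, restrict_edges E (core E \<union> D)) k" if "finite D" "D \<subseteq> V - core E" for D
    using that
  proof (induction D rule: finite_induct)
    case empty
    show ?case using tpc by simp
  next
    case (insert v D)
    let ?U = "core E \<union> insert v D"
    have U: "?U - {v} = core E \<union> D" "?U \<subseteq> V" using insert core_subset[OF E] by auto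
    have "restrict_edges (restrict_edges E ?U) (?U - {v}) = restrict_edges E (core E \<union> D)"
      using U by (auto simp: restrict_edges_def)
    moreover have "v \<notin> core (restrict_edges E ?U)"
      using core_restrict_subset[of E ?U] insert.prems by blast
    ultimately show ?case
      using insert TPC_add_irrelevant[OF finite_subset[OF U(2) V] restrict_edges_nsets[OF E], of v k] U(1)
      by auto
  qed
  from this[of "V - core E"] have "TPC (core E \<union> V, restrict_edges E (core E \<union> V)) k" using V by simp
  moreover have "core E \<union> V = V" using core_subset[OF E] by blast
  moreover have "restrict_edges E V = E" using E by (auto simp: restrict_edges_def nsets_def)
  ultimately show "TPC (V, E) k" by simp
qed (rule TPC_restrict[OF V E])

section \<open>Renaming vertices\<close>

lemma image_nsets_2:
  assumes "inj_on f V" "E \<subseteq> [V]\<^bsup>2\<^esup>"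
  shows "(`) f ` E \<subseteq> [f ` V]\<^bsup>2\<^esup>"
proof
  fix e assume "e \<in> (`) f ` E"
  then obtain e' where e': "e' \<in> [V]\<^bsup>2\<^esup>" "e = f ` e'" using assms by blast
  then have "inj_on f e'" using assms(1) by (auto simp: nsets_def inj_on_subset)
  with e' show "e \<in> [f ` V]\<^bsup>2\<^esup>" by (auto simp: nsets_def card_image)
qed

lemma TPC_image:
  assumes V: "finite V" and E: "E \<subseteq> [V]\<^bsup>2\<^esup>" and f: "inj_on f V" and tpc: "TPC (V, E) k"
  shows "TPC (f ` V, (`) f ` E) k"
proof -
  obtain S where S: "S \<subseteq> [V]\<^bsup>2\<^esup> - E" "card S \<le> k"
    and no: "\<And>a b c d. \<not> obstruction (E \<union> S) a b c d"
    using tpc unfolding TPC_iff[OF E] by blast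
  have finS: "finite S"
    using S(1) V finite_imp_finite_nsets by (metis finite_Diff finite_subset)
  have inj: "inj_on ((`) f) (Pow V)" by (rule inj_on_image_Pow[OF f])
  have nP: "[V]\<^bsup>2\<^esup> \<subseteq> Pow V" by (auto simp: nsets_def)
  have ES: "E \<union> S \<subseteq> [V]\<^bsup>2\<^esup>" using E S(1) by blast
  have edge: "{f x, f y} \<in> (`) f ` (E \<union> S) \<longleftrightarrow> {x, y} \<in> E \<union> S" if "x \<in> V" "y \<in> V" for x y
  proof -
    have "{x, y} \<in> Pow V" "E \<union> S \<subseteq> Pow V" using that ES nP by auto
    from inj_on_image_mem_iff[OF inj this] show ?thesis by simp
  qed
  have "\<not> obstruction ((`) f ` (E \<union> S)) a b c d" for a b c d
  proof
    assume obs: "obstruction ((`) f ` (E \<union> S)) a b c d"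
    have "{a, b, c, d} \<subseteq> f ` V" by (rule obstruction_verts[OF image_nsets_2[OF f ES] obs])
    then obtain a' b' c' d' where "a' \<in> V" "b' \<in> V" "c' \<in> V" "d' \<in> V"
      "a = f a'" "b = f b'" "c = f c'" "d = f d'" by auto
    then have "obstruction (E \<union> S) a' b' c' d'" using obs unfolding obstruction_def by (auto simp only: edge)
    with no show False by blast
  qed
  then have "\<forall>a b c d. \<not> obstruction ((`) f ` E \<union> (`) f ` S) a b c d" by (simp add: image_Un)
  moreover have "card ((`) f ` S) \<le> k" using card_image_le[OF finS, of "(`) f"] S(2) by simp
  moreover have "(`) f ` S \<subseteq> [f ` V]\<^bsup>2\<^esup> - (`) f ` E"
  proof -
    have "(`) f ` S \<subseteq> [f ` V]\<^bsup>2\<^esup>" using image_nsets_2[OF f, of S] S(1) by blast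
    moreover have "(`) f ` S \<inter> (`) f ` E = (`) f ` (S \<inter> E)"
      by (rule inj_on_image_Int[OF inj, symmetric]) (use E S(1) nP in blast)+
    moreover have "S \<inter> E = {}" using S(1) by blast
    ultimately have "(`) f ` S \<inter> (`) f ` E = {}" by simp
    with \<open>(`) f ` S \<subseteq> [f ` V]\<^bsup>2\<^esup>\<close> show ?thesis by (simp add: disjoint_iff subset_iff)
  qed
  ultimately show ?thesis unfolding TPC_iff[OF image_nsets_2[OF f E]] by blast
qed

text \<open>The output must live on an initial segment of the naturals. The two directions are
  \<open>TPC_image\<close> along \<open>g\<close> and along its inverse.\<close>

lemma TPC_relabel:
  fixes g :: "nat \<Rightarrow> 'a"
  assumes U: "finite U" and g: "bij_betw g {..<m} U" and E: "E \<subseteq> [U]\<^bsup>2\<^esup>"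
  defines "E' \<equiv> {{i, j} | i j. i < m \<and> j < m \<and> {g i, g j} \<in> E}"
  shows "E' \<subseteq> [{..<m}]\<^bsup>2\<^esup>" "TPC ({..<m}, E') k \<longleftrightarrow> TPC (U, E) k"
proof -
  have gi: "inj_on g {..<m}" "g ` {..<m} = U" using g by (auto simp: bij_betw_def)
  show E': "E' \<subseteq> [{..<m}]\<^bsup>2\<^esup>"
  proof
    fix e assume "e \<in> E'"
    then obtain i j where ij: "e = {i, j}" "i < m" "j < m" "{g i, g j} \<in> E" by (auto simp: E'_def)
    then have "i \<noteq> j" using edge_in_nsets(3)[OF E ij(4)] by auto
    with ij show "e \<in> [{..<m}]\<^bsup>2\<^esup>" by (auto simp: nsets_def)
  qed
  have im: "(`) g ` E' = E"
  proof (intro equalityI subsetI)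
    fix e assume e: "e \<in> E"
    then have "e \<in> [U]\<^bsup>2\<^esup>" using E by blast
    then obtain x y where xy: "e = {x, y}" "x \<in> U" "y \<in> U"
      by (auto simp: nsets_def card_2_iff)
    then obtain i j where "i < m" "j < m" "x = g i" "y = g j" using gi(2) by force
    then show "e \<in> (`) g ` E'" using e xy by (intro image_eqI[of _ _ "{i, j}"]) (auto simp: E'_def)
  qed (auto simp: E'_def)
  let ?h = "inv_into {..<m} g"
  have h: "?h ` g ` e = e" if "e \<subseteq> {..<m}" for e using that gi(1) by (rule inv_into_image_cancel[rotated])
  have "(`) ?h ` E = E'"
  proof -
    have "e \<subseteq> {..<m}" if "e \<in> E'" for e using that E' by (auto simp: nsets_def)
    then have "?h ` g ` e = e" if "e \<in> E'" for e by (rule h[OF _]) (rule that)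
    then have "(\<lambda>e. ?h ` g ` e) ` E' = E'" by (rule image_cong[OF refl, of _ _ id, simplified])
    then show ?thesis unfolding im[symmetric] image_image[of "(`) ?h"] .
  qed
  moreover have "inj_on ?h U" "?h ` U = {..<m}" using gi h[of "{..<m}"] inj_on_inv_into[of U g "{..<m}"] by auto
  ultimately have "TPC ({..<m}, E') k" if "TPC (U, E) k"
    using TPC_image[OF U E _ that, of ?h] by simp
  moreover have "TPC (U, E) k" if "TPC ({..<m}, E') k"
    using TPC_image[OF finite_lessThan E' gi(1) that] gi(2) im by simp
  ultimately show "TPC ({..<m}, E') k \<longleftrightarrow> TPC (U, E) k" by blast
qed

section \<open>Weakest preconditions with time bounds\<close>

notation Seq (infixr ";;" 60)

abbreviation reg :: "nat \<Rightarrow> aexp" where "reg r \<equiv> Cell r (Const 0)"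
abbreviation set_reg :: "nat \<Rightarrow> aexp \<Rightarrow> com" where "set_reg r e \<equiv> Assign r (Const 0) e"

text \<open>\<open>B\<close> stands for a common bound on the iterations of every loop. The branches
  of a conditional are added, not maximised, so that the result is a polynomial in
  \<open>B\<close>.\<close>

primrec time_bound :: "nat \<Rightarrow> com \<Rightarrow> nat" where
  "time_bound B Skip = 1"
| "time_bound B (Assign a i e) = 1"
| "time_bound B (Read a i) = 1"
| "time_bound B (Write b) = 1"
| "time_bound B (Seq c d) = time_bound B c + time_bound B d"
| "time_bound B (Cond b c d) = 1 + time_bound B c + time_bound B d"
| "time_bound B (While b c) = 1 + B * (1 + time_bound B c)"

lemma time_bound_poly: "\<exists>p :: nat poly. \<forall>B. time_bound B c = poly p B"
proof (induction c)
  case (Seq c d)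
  then obtain p q where "\<forall>B. time_bound B c = poly p B" "\<forall>B. time_bound B d = poly q B" by blast
  then show ?case by (intro exI[of _ "p + q"]) simp
next
  case (Cond b c d)
  then obtain p q where "\<forall>B. time_bound B c = poly p B" "\<forall>B. time_bound B d = poly q B" by blast
  then show ?case by (intro exI[of _ "1 + p + q"]) simp
next
  case (While b c)
  then obtain p where "\<forall>B. time_bound B c = poly p B" by blast
  then show ?case by (intro exI[of _ "1 + [:0, 1:] * (1 + p)"]) simp
qed (auto intro!: exI[of _ 1])

text \<open>Total correctness with the time bound built in. The bound depends only on
  \<open>B\<close> and the program text, so derivations never count steps; they only have to show
  that no loop exceeds \<open>B\<close> iterations.\<close>

definition wp :: "nat \<Rightarrow> com \<Rightarrow> (config \<Rightarrow> bool) \<Rightarrow> config \<Rightarrow> bool" where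
  "wp B c Q s \<longleftrightarrow> (\<exists>t s'. exec c s t s' \<and> t \<le> time_bound B c \<and> Q s')"

lemma wpI: "exec c s t s' \<Longrightarrow> t \<le> time_bound B c \<Longrightarrow> Q s' \<Longrightarrow> wp B c Q s"
  unfolding wp_def by blast

lemma wpE:
  assumes "wp B c Q s"
  obtains t s' where "exec c s t s'" "t \<le> time_bound B c" "Q s'"
  using assms unfolding wp_def by blast

lemma wp_mono: "wp B c P s \<Longrightarrow> (\<And>s'. P s' \<Longrightarrow> Q s') \<Longrightarrow> wp B c Q s"
  by (blast intro: wpI elim: wpE)

lemma wp_Skip: "Q s \<Longrightarrow> wp B Skip Q s"
  by (rule wpI[OF exec.Skip]) simp_all

lemma wp_Assign:
  "Q (store m a (aval i m) (aval e m), xs, ys) \<Longrightarrow> wp B (Assign a i e) Q (m, xs, ys)"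
  by (rule wpI[OF exec.Assign]) simp_all

lemma wp_Read_Cons:
  "Q (store m a (aval i m) (of_bool x), xs, ys) \<Longrightarrow> wp B (Read a i) Q (m, x # xs, ys)"
  by (rule wpI[OF exec.ReadBit]) simp_all

lemma wp_Read_Nil:
  "Q (store m a (aval i m) 2, [], ys) \<Longrightarrow> wp B (Read a i) Q (m, [], ys)"
  by (rule wpI[OF exec.ReadEnd]) simp_all

lemma wp_Write: "Q (m, xs, ys @ [bval b m]) \<Longrightarrow> wp B (Write b) Q (m, xs, ys)"
  by (rule wpI[OF exec.Write]) simp_all

lemma wp_Seq:
  assumes "wp B c (wp B d Q) s" shows "wp B (c ;; d) Q s"
proof -
  obtain t s' where 1: "exec c s t s'" "t \<le> time_bound B c" "wp B d Q s'"
    using assms by (rule wpE)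
  obtain u s'' where 2: "exec d s' u s''" "u \<le> time_bound B d" "Q s''"
    using 1(3) by (rule wpE)
  have "exec (c ;; d) s (t + u) s''" by (rule exec.Seq[OF 1(1) 2(1)])
  moreover have "t + u \<le> time_bound B (c ;; d)" using 1(2) 2(2) by simp
  ultimately show ?thesis using 2(3) unfolding wp_def by blast
qed

lemma wp_Seq_mono:
  assumes "wp B c P s" "\<And>s'. P s' \<Longrightarrow> wp B d Q s'"
  shows "wp B (c ;; d) Q s"
  using assms by (blast intro: wp_Seq wp_mono)

lemma wp_Cond:
  assumes "bval b (fst s) \<Longrightarrow> wp B c Q s" "\<not> bval b (fst s) \<Longrightarrow> wp B d Q s"
  shows "wp B (Cond b c d) Q s"
proof (cases "bval b (fst s)")
  case True
  obtain t s' where 1: "exec c s t s'" "t \<le> time_bound B c" "Q s'"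
    using assms(1)[OF True] by (rule wpE)
  have "exec (Cond b c d) s (1 + t) s'" by (rule exec.CondTrue[OF True 1(1)])
  moreover have "1 + t \<le> time_bound B (Cond b c d)" using 1(2) by simp
  ultimately show ?thesis using 1(3) unfolding wp_def by blast
next
  case False
  obtain t s' where 1: "exec d s t s'" "t \<le> time_bound B d" "Q s'"
    using assms(2)[OF False] by (rule wpE)
  have "exec (Cond b c d) s (1 + t) s'" by (rule exec.CondFalse[OF False 1(1)])
  moreover have "1 + t \<le> time_bound B (Cond b c d)" using 1(2) by simp
  ultimately show ?thesis using 1(3) unfolding wp_def by blast
qed

text \<open>The index \<open>v\<close> of the invariant is a variant: it drops in each iteration and
  starts at most at \<open>B\<close>. An iteration costs its test and its body, and the final
  failing test accounts for the additional 1.\<close>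

lemma wp_While:
  assumes "I v s" "v \<le> B"
    and body: "\<And>v s. I v s \<Longrightarrow> bval b (fst s) \<Longrightarrow> wp B c (\<lambda>s'. \<exists>v'<v. I v' s') s"
    and exit: "\<And>v s. I v s \<Longrightarrow> \<not> bval b (fst s) \<Longrightarrow> Q s"
  shows "wp B (While b c) Q s"
proof -
  have "\<exists>t s'. exec (While b c) s t s' \<and> t \<le> 1 + v * (1 + time_bound B c) \<and> Q s'" if "I v s"
    using that
  proof (induction v arbitrary: s rule: less_induct)
    case (less v)
    show ?case
    proof (cases "bval b (fst s)")
      case False
      have "exec (While b c) s 1 s" "Q s" using exec.WhileFalse[OF False] exit[OF less.prems False] by auto
      then show ?thesis by (intro exI[of _ 1] exI[of _ s]) simp
    next
      case True
      then obtain t s' v' where 1: "exec c s t s'" "t \<le> time_bound B c" "v' < v" "I v' s'"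
        using body[OF less.prems True] by (blast elim: wpE)
      obtain u s'' where 2: "exec (While b c) s' u s''" "u \<le> 1 + v' * (1 + time_bound B c)" "Q s''"
        using less.IH[OF 1(3,4)] by blast
      have "exec (While b c) s (1 + t + u) s''" by (rule exec.WhileTrue[OF True 1(1) 2(1)])
      moreover have "1 + t + u \<le> 1 + v * (1 + time_bound B c)"
      proof -
        have "1 + t + u \<le> 1 + Suc v' * (1 + time_bound B c)" using 1(2) 2(2) by simp
        also have "\<dots> \<le> 1 + v * (1 + time_bound B c)"
          using 1(3) by (intro add_left_mono mult_right_mono) simp_all
        finally show ?thesis .
      qed
      ultimately show ?thesis using 2(3) by blast
    qed
  qed
  then obtain t s' where 1: "exec (While b c) s t s'" "t \<le> 1 + v * (1 + time_bound B c)" "Q s'"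
    using assms(1) by blast
  have "t \<le> time_bound B (While b c)"
    using 1(2) mult_right_mono[OF assms(2), of "1 + time_bound B c"] by simp
  with 1 show ?thesis unfolding wp_def by blast
qed

section \<open>Counting loops\<close>

definition for_loop :: "nat \<Rightarrow> nat \<Rightarrow> com \<Rightarrow> com" where
  "for_loop r N c = set_reg r (Const 0) ;;
     While (Less (reg r) (reg N)) (c ;; set_reg r (Add (reg r) (Const 1)))"

text \<open>\<open>I i\<close> describes the loop head, where register \<open>r\<close> holds
  \<open>i\<close>. The increment is folded into the postcondition of the body, which therefore
  establishes \<open>I (Suc i)\<close> for the memory after the update of \<open>r\<close>.\<close>

lemma wp_for:
  assumes start: "I 0 (store m r 0 0, xs, ys)" and n: "n \<le> B"
    and regs: "\<And>i m' xs' ys'. I i (m', xs', ys') \<Longrightarrow> m' r 0 = i \<and> m' N 0 = n"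
    and body: "\<And>i m' xs' ys'. i < n \<Longrightarrow> I i (m', xs', ys') \<Longrightarrow>
      wp B c (\<lambda>(m'', xs'', ys''). m'' r 0 = i \<and> I (Suc i) (store m'' r 0 (Suc i), xs'', ys''))
        (m', xs', ys')"
    and exit: "\<And>s. I n s \<Longrightarrow> Q s"
  shows "wp B (for_loop r N c) Q (m, xs, ys)"
  unfolding for_loop_def
proof (rule wp_Seq, rule wp_Assign,
    rule wp_While[where v = n and I = "\<lambda>v s. \<exists>i \<le> n. v = n - i \<and> I i s"])
  show "\<exists>i \<le> n. n = n - i \<and> I i (store m r (aval (Const 0) m) (aval (Const 0) m), xs, ys)"
    using start by (intro exI[of _ 0]) simp
  fix v s assume "\<exists>i \<le> n. v = n - i \<and> I i s"
  then obtain i where i: "i \<le> n" "v = n - i" "I i s" by blast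
  obtain m' xs' ys' where s: "s = (m', xs', ys')" by (cases s)
  have reg: "m' r 0 = i" "m' N 0 = n" using regs i(3) s by blast+
  { assume "bval (Less (reg r) (reg N)) (fst s)"
    then have lt: "i < n" using reg s by simp
    show "wp B (c ;; set_reg r (Add (reg r) (Const 1))) (\<lambda>s'. \<exists>v'<v. \<exists>i \<le> n. v' = n - i \<and> I i s') s"
      unfolding s
    proof (rule wp_Seq, rule wp_mono[OF body[OF lt i(3)[unfolded s]]])
      fix s'
      assume "case s' of (m'', xs'', ys'') \<Rightarrow> m'' r 0 = i \<and> I (Suc i) (store m'' r 0 (Suc i), xs'', ys'')"
      moreover obtain m'' xs'' ys'' where s': "s' = (m'', xs'', ys'')" by (cases s')
      ultimately have "m'' r 0 = i" "I (Suc i) (store m'' r 0 (Suc i), xs'', ys'')" by auto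
      moreover have "n - Suc i < v" "Suc i \<le> n" using lt i(2) by auto
      ultimately show "wp B (set_reg r (Add (reg r) (Const 1))) (\<lambda>s'. \<exists>v'<v. \<exists>i \<le> n. v' = n - i \<and> I i s') s'"
        unfolding s' by (intro wp_Assign exI[of _ "n - Suc i"] exI[of _ "Suc i"] conjI refl) simp_all
    qed }
  { assume "\<not> bval (Less (reg r) (reg N)) (fst s)"
    then have "i = n" using reg s i(1) by simp
    then show "Q s" using exit i(3) by simp }
qed (rule n)

section \<open>Framing, and programs that accumulate a number or append output\<close>

lemma store_apply: "store m a i v b j = (if b = a \<and> j = i then v else m b j)"
  by (simp add: store_def)

text \<open>The frame condition: only arrays listed in \<open>R\<close> may change. It works with
  whole arrays, since most of them serve as registers.\<close>

definition agree :: "nat set \<Rightarrow> memory \<Rightarrow> memory \<Rightarrow> bool" where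
  "agree R m m' \<longleftrightarrow> (\<forall>x. x \<notin> R \<longrightarrow> m' x = m x)"

lemma agree_refl: "agree R m m"
  by (simp add: agree_def)

lemma agree_trans: "agree R m m' \<Longrightarrow> agree R m' m'' \<Longrightarrow> agree R m m''"
  by (simp add: agree_def)

lemma agreeD: "agree R m m' \<Longrightarrow> x \<notin> R \<Longrightarrow> m' x = m x"
  by (simp add: agree_def)

text \<open>The register is increased rather than set, so that wrapping the program in a loop turns
  \<open>f\<close> into a sum of its values.\<close>

definition counter :: "nat \<Rightarrow> nat set \<Rightarrow> nat \<Rightarrow> com \<Rightarrow> (memory \<Rightarrow> bool) \<Rightarrow> (memory \<Rightarrow> nat) \<Rightarrow> bool" where
  "counter B R q c pre f \<longleftrightarrow> (\<forall>m xs ys. pre m \<longrightarrow>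
     wp B c (\<lambda>(m', xs', ys'). xs' = xs \<and> ys' = ys \<and> agree (insert q R) m m' \<and> m' q 0 = m q 0 + f m)
       (m, xs, ys))"

text \<open>By the assumption on \<open>f\<close>, its value is insensitive to what the body
  changes. The total can therefore be expressed in the initial memory, with only the loop register
  replaced.\<close>

lemma counter_for:
  assumes c: "counter B R q c pre f"
    and r: "r \<notin> insert q R" and N: "N \<notin> insert r (insert q R)"
    and pre: "\<And>m m' i. pre' m \<Longrightarrow> i < m N 0 \<Longrightarrow> agree (insert q R) (store m r 0 i) m' \<Longrightarrow> pre m'"
    and f: "\<And>m m'. agree (insert q R) m m' \<Longrightarrow> f m' = f m"
    and B: "\<And>m. pre' m \<Longrightarrow> m N 0 \<le> B"
  shows "counter B (insert r R) q (for_loop r N c) pre' (\<lambda>m. \<Sum>i<m N 0. f (store m r 0 i))"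
  unfolding counter_def
proof (intro allI impI)
  fix m xs ys assume pre': "pre' m"
  let ?S = "\<lambda>i. \<Sum>j<i. f (store m r 0 j)"
  show "wp B (for_loop r N c) (\<lambda>(m', xs', ys'). xs' = xs \<and> ys' = ys \<and>
      agree (insert q (insert r R)) m m' \<and> m' q 0 = m q 0 + ?S (m N 0)) (m, xs, ys)"
  proof (rule wp_for[where n = "m N 0" and I = "\<lambda>i (m', xs', ys'). xs' = xs \<and> ys' = ys \<and>
      agree (insert q R) (store m r 0 i) m' \<and> m' q 0 = m q 0 + ?S i"])
    show "m N 0 \<le> B" by (rule B[OF pre'])
  next
    fix i m' xs' ys'
    assume "case (m', xs', ys') of (m', xs', ys') \<Rightarrow> xs' = xs \<and> ys' = ys \<and>
      agree (insert q R) (store m r 0 i) m' \<and> m' q 0 = m q 0 + ?S i"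
    then have *: "xs' = xs" "ys' = ys" "agree (insert q R) (store m r 0 i) m'" "m' q 0 = m q 0 + ?S i"
      by auto
    show "m' r 0 = i \<and> m' N 0 = m N 0"
      using agreeD[OF *(3) r] agreeD[OF *(3), of N] N by (simp add: store_apply)
    assume i: "i < m N 0"
    show "wp B c (\<lambda>(m'', xs'', ys''). m'' r 0 = i \<and>
        (case (store m'' r 0 (Suc i), xs'', ys'') of (m', xs', ys') \<Rightarrow> xs' = xs \<and> ys' = ys \<and>
          agree (insert q R) (store m r 0 (Suc i)) m' \<and> m' q 0 = m q 0 + ?S (Suc i))) (m', xs', ys')"
    proof (rule wp_mono[OF c[unfolded counter_def, rule_format, OF pre[OF pre' i *(3)]]])
      fix s
      assume "case s of (m'', xs'', ys'') \<Rightarrow>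
        xs'' = xs' \<and> ys'' = ys' \<and> agree (insert q R) m' m'' \<and> m'' q 0 = m' q 0 + f m'"
      then obtain m'' where s: "s = (m'', xs', ys')" "agree (insert q R) m' m''"
        "m'' q 0 = m' q 0 + f m'" by auto
      note a = agree_trans[OF *(3) s(2)]
      have "m'' r 0 = i" using agreeD[OF a r] by (simp add: store_apply)
      moreover have "agree (insert q R) (store m r 0 (Suc i)) (store m'' r 0 (Suc i))"
        using a by (auto simp: agree_def store_def fun_eq_iff)
      moreover have "f m' = f (store m r 0 i)" by (rule f[OF *(3)])
      moreover have "q \<noteq> r" using r by auto
      ultimately show "case s of (m'', xs'', ys'') \<Rightarrow> m'' r 0 = i \<and>
        (case (store m'' r 0 (Suc i), xs'', ys'') of (m', xs', ys') \<Rightarrow> xs' = xs \<and> ys' = ys \<and>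
          agree (insert q R) (store m r 0 (Suc i)) m' \<and> m' q 0 = m q 0 + ?S (Suc i))"
        using s *(1,2,4) by (simp add: store_apply)
    qed
  next
    fix s
    assume "case s of (m', xs', ys') \<Rightarrow> xs' = xs \<and> ys' = ys \<and>
      agree (insert q R) (store m r 0 (m N 0)) m' \<and> m' q 0 = m q 0 + ?S (m N 0)"
    then show "case s of (m', xs', ys') \<Rightarrow> xs' = xs \<and> ys' = ys \<and>
      agree (insert q (insert r R)) m m' \<and> m' q 0 = m q 0 + ?S (m N 0)"
      by (auto simp: agree_def store_def)
  qed (use r in \<open>auto simp: agree_refl store_apply\<close>)
qed

text \<open>The analogue of \<open>counter\<close> for the output tape: a surrounding loop
  concatenates the values of \<open>f\<close>.\<close>

definition writer :: "nat \<Rightarrow> nat set \<Rightarrow> com \<Rightarrow> (memory \<Rightarrow> bool) \<Rightarrow> (memory \<Rightarrow> bool list) \<Rightarrow> bool" where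
  "writer B R c pre f \<longleftrightarrow> (\<forall>m xs ys. pre m \<longrightarrow>
     wp B c (\<lambda>(m', xs', ys'). xs' = xs \<and> ys' = ys @ f m \<and> agree R m m') (m, xs, ys))"

lemma writer_for:
  assumes c: "writer B R c pre f"
    and r: "r \<notin> R" and N: "N \<notin> insert r R"
    and pre: "\<And>m m' i. pre' m \<Longrightarrow> i < m N 0 \<Longrightarrow> agree R (store m r 0 i) m' \<Longrightarrow> pre m'"
    and f: "\<And>m m'. agree R m m' \<Longrightarrow> f m' = f m"
    and B: "\<And>m. pre' m \<Longrightarrow> m N 0 \<le> B"
  shows "writer B (insert r R) (for_loop r N c) pre' (\<lambda>m. concat (map (\<lambda>i. f (store m r 0 i)) [0..<m N 0]))"
  unfolding writer_def
proof (intro allI impI)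
  fix m xs ys assume pre': "pre' m"
  let ?S = "\<lambda>i. concat (map (\<lambda>i. f (store m r 0 i)) [0..<i])"
  show "wp B (for_loop r N c) (\<lambda>(m', xs', ys'). xs' = xs \<and> ys' = ys @ ?S (m N 0) \<and>
      agree (insert r R) m m') (m, xs, ys)"
  proof (rule wp_for[where n = "m N 0" and I = "\<lambda>i (m', xs', ys'). xs' = xs \<and> ys' = ys @ ?S i \<and>
      agree R (store m r 0 i) m'"])
    show "m N 0 \<le> B" by (rule B[OF pre'])
  next
    fix i m' xs' ys'
    assume "case (m', xs', ys') of (m', xs', ys') \<Rightarrow> xs' = xs \<and> ys' = ys @ ?S i \<and>
      agree R (store m r 0 i) m'"
    then have *: "xs' = xs" "ys' = ys @ ?S i" "agree R (store m r 0 i) m'" by auto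
    show "m' r 0 = i \<and> m' N 0 = m N 0"
      using agreeD[OF *(3) r] agreeD[OF *(3), of N] N by (simp add: store_apply)
    assume i: "i < m N 0"
    show "wp B c (\<lambda>(m'', xs'', ys''). m'' r 0 = i \<and>
        (case (store m'' r 0 (Suc i), xs'', ys'') of (m', xs', ys') \<Rightarrow> xs' = xs \<and> ys' = ys @ ?S (Suc i) \<and>
          agree R (store m r 0 (Suc i)) m')) (m', xs', ys')"
    proof (rule wp_mono[OF c[unfolded writer_def, rule_format, OF pre[OF pre' i *(3)]]])
      fix s
      assume "case s of (m'', xs'', ys'') \<Rightarrow> xs'' = xs' \<and> ys'' = ys' @ f m' \<and> agree R m' m''"
      then obtain m'' where s: "s = (m'', xs', ys' @ f m')" "agree R m' m''" by auto
      note a = agree_trans[OF *(3) s(2)]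
      have "m'' r 0 = i" using agreeD[OF a r] by (simp add: store_apply)
      moreover have "agree R (store m r 0 (Suc i)) (store m'' r 0 (Suc i))"
        using a by (auto simp: agree_def store_def fun_eq_iff)
      moreover have "f m' = f (store m r 0 i)" by (rule f[OF *(3)])
      ultimately show "case s of (m'', xs'', ys'') \<Rightarrow> m'' r 0 = i \<and>
        (case (store m'' r 0 (Suc i), xs'', ys'') of (m', xs', ys') \<Rightarrow> xs' = xs \<and> ys' = ys @ ?S (Suc i) \<and>
          agree R (store m r 0 (Suc i)) m')"
        using s *(1,2) by simp
    qed
  next
    fix s
    assume "case s of (m', xs', ys') \<Rightarrow> xs' = xs \<and> ys' = ys @ ?S (m N 0) \<and>
      agree R (store m r 0 (m N 0)) m'"
    then show "case s of (m', xs', ys') \<Rightarrow> xs' = xs \<and> ys' = ys @ ?S (m N 0) \<and> agree (insert r R) m m'"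
      by (auto simp: agree_def store_def)
  qed (use r in \<open>auto simp: agree_refl store_apply\<close>)
qed

section \<open>The reduction program\<close>

abbreviation (input) nReg :: nat where "nReg \<equiv> 0"
abbreviation (input) adjA :: nat where "adjA \<equiv> 1"
abbreviation (input) rowA :: nat where "rowA \<equiv> 2"
abbreviation (input) kReg :: nat where "kReg \<equiv> 3"
abbreviation (input) xReg :: nat where "xReg \<equiv> 4"
abbreviation (input) aReg :: nat where "aReg \<equiv> 5"
abbreviation (input) bReg :: nat where "bReg \<equiv> 6"
abbreviation (input) cReg :: nat where "cReg \<equiv> 7"
abbreviation (input) dReg :: nat where "dReg \<equiv> 8"
abbreviation (input) cntReg :: nat where "cntReg \<equiv> 9"
abbreviation (input) chgReg :: nat where "chgReg \<equiv> 10"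
abbreviation (input) mReg :: nat where "mReg \<equiv> 11"
abbreviation (input) listA :: nat where "listA \<equiv> 12"
abbreviation (input) sqReg :: nat where "sqReg \<equiv> 13"
abbreviation (input) iReg :: nat where "iReg \<equiv> 14"
abbreviation (input) powA :: nat where "powA \<equiv> 15"

text \<open>The machine cannot multiply, so \<open>rowA\<close> tabulates the offsets \<open>i * n\<close> of the rows of the adjacency matrix.\<close>

definition represents :: "memory \<Rightarrow> nat \<Rightarrow> nat set set \<Rightarrow> bool" where
  "represents m n E \<longleftrightarrow> m nReg 0 = n \<and> (\<forall>i<n. m rowA i = i * n) \<and>
     (\<forall>i<n. \<forall>j<n. m adjA (i * n + j) = of_bool ({i, j} \<in> E))"

lemma represents_agree:
  "represents m n E \<Longrightarrow> agree R m m' \<Longrightarrow> R \<inter> {nReg, adjA, rowA} = {} \<Longrightarrow> represents m' n E"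
  unfolding represents_def agree_def by auto

lemma represents_store:
  "r \<notin> {nReg, adjA, rowA} \<Longrightarrow> represents (store m r i v) n E \<longleftrightarrow> represents m n E"
  unfolding represents_def by (simp add: store_apply)

section \<open>Testing edges and counting obstructions\<close>

definition edge_test :: "aexp \<Rightarrow> aexp \<Rightarrow> bexp" where
  "edge_test e f = Equal (Cell adjA (Add (Cell rowA e) f)) (Const 1)"

lemma bval_edge_test:
  assumes "represents m n E" "aval e m < n" "aval f m < n"
  shows "bval (edge_test e f) m \<longleftrightarrow> {aval e m, aval f m} \<in> E"
  using assms by (simp add: edge_test_def represents_def)

definition obstruction_test :: "nat \<Rightarrow> nat \<Rightarrow> nat \<Rightarrow> nat \<Rightarrow> bexp" where
  "obstruction_test a b c d = Conj (edge_test (reg a) (reg b)) (Conj (edge_test (reg b) (reg c))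
     (Conj (edge_test (reg c) (reg d)) (Conj (Neg (edge_test (reg a) (reg c)))
     (Conj (Neg (edge_test (reg b) (reg d))) (Conj (Neg (Equal (reg a) (reg c)))
     (Neg (Equal (reg b) (reg d))))))))"

lemma bval_obstruction_test:
  assumes "represents m n E" "m a 0 < n" "m b 0 < n" "m c 0 < n" "m d 0 < n"
  shows "bval (obstruction_test a b c d) m \<longleftrightarrow> obstruction E (m a 0) (m b 0) (m c 0) (m d 0)"
  using assms by (simp add: obstruction_test_def obstruction_def bval_edge_test)

lemma counter_cong:
  assumes "counter B R q c pre f" "\<And>m. pre m \<Longrightarrow> f m = g m"
  shows "counter B R q c pre g"
  using assms unfolding counter_def by simp

definition increment :: "nat \<Rightarrow> com" where
  "increment q = set_reg q (Add (reg q) (Const 1))"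

lemma counter_Cond:
  assumes "\<And>m. pre m \<Longrightarrow> bval b m \<longleftrightarrow> P m"
  shows "counter B {} q (Cond b (increment q) Skip) pre (\<lambda>m. of_bool (P m))"
  unfolding counter_def increment_def
  by (auto intro!: wp_Cond wp_Assign wp_Skip simp: assms agree_def store_def)

lemma counter_Seq:
  assumes c: "counter B {} q c pre f" and d: "counter B {} q d pre g"
    and pre: "\<And>m m'. pre m \<Longrightarrow> agree {q} m m' \<Longrightarrow> pre m'"
    and g: "\<And>m m'. agree {q} m m' \<Longrightarrow> g m' = g m"
  shows "counter B {} q (c ;; d) pre (\<lambda>m. f m + g m)"
  unfolding counter_def
proof (intro allI impI)
  fix m xs ys assume m: "pre m"
  show "wp B (c ;; d) (\<lambda>(m', xs', ys'). xs' = xs \<and> ys' = ys \<and> agree {q} m m' \<and>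
      m' q 0 = m q 0 + (f m + g m)) (m, xs, ys)"
  proof (rule wp_Seq, rule wp_mono[OF c[unfolded counter_def, rule_format, OF m]])
    fix s assume "case s of (m', xs', ys') \<Rightarrow>
      xs' = xs \<and> ys' = ys \<and> agree {q} m m' \<and> m' q 0 = m q 0 + f m"
    then obtain m' where s: "s = (m', xs, ys)" "agree {q} m m'" "m' q 0 = m q 0 + f m" by auto
    show "wp B d (\<lambda>(m', xs', ys'). xs' = xs \<and> ys' = ys \<and> agree {q} m m' \<and>
      m' q 0 = m q 0 + (f m + g m)) s"
      unfolding s(1)
      by (rule wp_mono[OF d[unfolded counter_def, rule_format, OF pre[OF m s(2)]]])
        (use s(2,3) g[OF s(2)] in \<open>auto intro: agree_trans\<close>)
  qed
qed

definition count_partners :: com where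
  "count_partners = for_loop bReg nReg (for_loop dReg nReg
     (Cond (obstruction_test aReg bReg cReg dReg) (increment cntReg) Skip))"

lemma sum_of_bool_pairs:
  fixes P :: "nat \<Rightarrow> nat \<Rightarrow> bool"
  shows "(\<Sum>b<n. \<Sum>d<n. of_bool (P b d)) = card {(b, d). b < n \<and> d < n \<and> P b d}"
proof -
  have "{(b, d). b < n \<and> d < n \<and> P b d} = (SIGMA b:{..<n}. {d. d < n \<and> P b d})" by auto
  then show ?thesis by (simp add: card_SigmaI Int_def)
qed

lemma counter_count_partners:
  assumes "n \<le> B" and E: "E \<subseteq> [{..<n}]\<^bsup>2\<^esup>"
  shows "counter B {bReg, dReg} cntReg count_partners
    (\<lambda>m. represents m n E \<and> m aReg 0 < n \<and> m cReg 0 < n)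
    (\<lambda>m. card (partners E (m aReg 0) (m cReg 0)))"
proof -
  have 1: "counter B {} cntReg (Cond (obstruction_test aReg bReg cReg dReg) (increment cntReg) Skip)
    (\<lambda>m. represents m n E \<and> m aReg 0 < n \<and> m cReg 0 < n \<and> m bReg 0 < n \<and> m dReg 0 < n)
    (\<lambda>m. of_bool (obstruction E (m aReg 0) (m bReg 0) (m cReg 0) (m dReg 0)))"
    by (rule counter_Cond, rule bval_obstruction_test[where n = n]) auto
  have n: "represents m n E \<Longrightarrow> m 0 0 = n" for m by (simp add: represents_def)
  have 2: "counter B {dReg} cntReg (for_loop dReg nReg
      (Cond (obstruction_test aReg bReg cReg dReg) (increment cntReg) Skip))
    (\<lambda>m. represents m n E \<and> m aReg 0 < n \<and> m cReg 0 < n \<and> m bReg 0 < n)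
    (\<lambda>m. \<Sum>d<m nReg 0. of_bool (obstruction E (m aReg 0) (m bReg 0) (m cReg 0) d))"
    by (rule counter_cong[OF counter_for[OF 1]])
      (use assms(1) in \<open>auto simp: store_apply agree_def represents_def\<close>)
  have 3: "counter B {bReg, dReg} cntReg count_partners
    (\<lambda>m. represents m n E \<and> m aReg 0 < n \<and> m cReg 0 < n)
    (\<lambda>m. \<Sum>b<m nReg 0. \<Sum>d<m nReg 0. of_bool (obstruction E (m aReg 0) b (m cReg 0) d))"
    unfolding count_partners_def
    by (rule counter_cong[OF counter_for[OF 2]])
      (use assms(1) in \<open>auto simp: store_apply agree_def represents_def\<close>)
  \<comment> \<open>Letting \<open>b\<close> and \<open>d\<close> range below \<open>n\<close> loses
    nothing, since obstructions lie in the vertex set.\<close>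
  have *: "{(b, d). b < n \<and> d < n \<and> obstruction E a b c d} = partners E a c" for a c
    using obstruction_verts[OF E] by (auto simp: partners_def)
  show ?thesis
    by (intro counter_cong[OF 3], elim conjE) (simp only: n sum_of_bool_pairs *)
qed

text \<open>The vertex in \<open>aReg\<close> is tried as first and as second vertex; by
  \<open>core_iff\<close> the other two positions are covered.\<close>

definition count_core :: com where
  "count_core = for_loop bReg nReg (for_loop cReg nReg (for_loop dReg nReg
     (Cond (obstruction_test aReg bReg cReg dReg) (increment cntReg) Skip ;;
      Cond (obstruction_test bReg aReg cReg dReg) (increment cntReg) Skip)))"

text \<open>The count may meet the same obstruction more than once, so its value is left open and
  only its positivity is specified.\<close>

lemma counter_count_core:
  assumes "n \<le> B" and E: "E \<subseteq> [{..<n}]\<^bsup>2\<^esup>"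
  shows "\<exists>f. counter B {bReg, cReg, dReg} cntReg count_core
    (\<lambda>m. represents m n E \<and> m aReg 0 < n) f \<and>
    (\<forall>m. represents m n E \<longrightarrow> (0 < f m \<longleftrightarrow> m aReg 0 \<in> core E))"
proof -
  let ?f = "\<lambda>m b c d. of_bool (obstruction E (m aReg 0) b c d) + of_bool (obstruction E b (m aReg 0) c d) :: nat"
  have 1: "counter B {} cntReg (Cond (obstruction_test aReg bReg cReg dReg) (increment cntReg) Skip ;;
      Cond (obstruction_test bReg aReg cReg dReg) (increment cntReg) Skip)
    (\<lambda>m. represents m n E \<and> m aReg 0 < n \<and> m bReg 0 < n \<and> m cReg 0 < n \<and> m dReg 0 < n)
    (\<lambda>m. ?f m (m bReg 0) (m cReg 0) (m dReg 0))"
    by (rule counter_Seq; (rule counter_Cond, rule bval_obstruction_test[where n = n])?)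
      (auto simp: agree_def intro: represents_agree[of _ _ _ "{cntReg}"])
  have n: "represents m n E \<Longrightarrow> m 0 0 = n" for m by (simp add: represents_def)
  have 2: "counter B {dReg} cntReg (for_loop dReg nReg
      (Cond (obstruction_test aReg bReg cReg dReg) (increment cntReg) Skip ;;
      Cond (obstruction_test bReg aReg cReg dReg) (increment cntReg) Skip))
    (\<lambda>m. represents m n E \<and> m aReg 0 < n \<and> m bReg 0 < n \<and> m cReg 0 < n)
    (\<lambda>m. \<Sum>d<m nReg 0. ?f m (m bReg 0) (m cReg 0) d)"
    by (rule counter_cong[OF counter_for[OF 1]])
      (use assms(1) in \<open>auto simp: store_apply agree_def represents_def\<close>)
  have 3: "counter B {cReg, dReg} cntReg (for_loop cReg nReg (for_loop dReg nReg
      (Cond (obstruction_test aReg bReg cReg dReg) (increment cntReg) Skip ;;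
      Cond (obstruction_test bReg aReg cReg dReg) (increment cntReg) Skip)))
    (\<lambda>m. represents m n E \<and> m aReg 0 < n \<and> m bReg 0 < n)
    (\<lambda>m. \<Sum>c<m nReg 0. \<Sum>d<m nReg 0. ?f m (m bReg 0) c d)"
    by (rule counter_cong[OF counter_for[OF 2]])
      (use assms(1) in \<open>auto simp: store_apply agree_def represents_def\<close>)
  have 4: "counter B {bReg, cReg, dReg} cntReg count_core
    (\<lambda>m. represents m n E \<and> m aReg 0 < n)
    (\<lambda>m. \<Sum>b<m nReg 0. \<Sum>c<m nReg 0. \<Sum>d<m nReg 0. ?f m b c d)"
    unfolding count_core_def
    by (rule counter_cong[OF counter_for[OF 3]])
      (use assms(1) in \<open>auto simp: store_apply agree_def represents_def\<close>)
  have pos: "0 < (\<Sum>b<n. \<Sum>c<n. \<Sum>d<n. ?f m b c d) \<longleftrightarrow> m aReg 0 \<in> core E" for m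
  proof -
    have "0 < (\<Sum>b<n. \<Sum>c<n. \<Sum>d<n. ?f m b c d) \<longleftrightarrow> (\<exists>b<n. \<exists>c<n. \<exists>d<n. 0 < ?f m b c d)"
      by (simp add: sum_eq_0_iff flip: neq0_conv) blast
    also have "\<dots> \<longleftrightarrow> m aReg 0 \<in> core E"
      using obstruction_verts[OF E] unfolding core_iff by fastforce
    finally show ?thesis .
  qed
  show ?thesis using 4 pos n by (intro exI conjI allI impI) auto
qed

section \<open>Applying the forced-edge rule exhaustively\<close>

definition set_edge :: "nat \<Rightarrow> nat \<Rightarrow> com" where
  "set_edge a b = Assign adjA (Add (Cell rowA (reg a)) (reg b)) (Const 1)"

text \<open>Both entries of the symmetric matrix are set. \<open>chgReg\<close> records that the
  current pass has added an edge.\<close>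

definition reduce_step :: com where
  "reduce_step = set_reg cntReg (Const 0) ;; count_partners ;;
     Cond (Conj (Less (Add (reg kReg) (reg kReg)) (reg cntReg)) (Less (Const 0) (reg kReg)))
       (set_edge aReg cReg ;; set_edge cReg aReg ;;
        set_reg kReg (Sub (reg kReg) (Const 1)) ;; set_reg chgReg (Const 1))
       Skip"

definition valid :: "nat \<Rightarrow> nat set set \<Rightarrow> nat \<Rightarrow> memory \<Rightarrow> nat set set \<Rightarrow> bool" where
  "valid n E0 k0 m E \<longleftrightarrow> represents m n E \<and> E \<subseteq> [{..<n}]\<^bsup>2\<^esup> \<and> m kReg 0 \<le> k0 \<and>
     (TPC ({..<n}, E) (m kReg 0) \<longleftrightarrow> TPC ({..<n}, E0) k0)"

lemma valid_cong:
  "(\<And>x. x \<in> {nReg, adjA, rowA, kReg} \<Longrightarrow> m' x = m x) \<Longrightarrow> valid n E0 k0 m' E \<longleftrightarrow> valid n E0 k0 m E"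
  unfolding valid_def represents_def by simp

lemma valid_store:
  "r \<notin> {nReg, adjA, rowA, kReg} \<Longrightarrow> valid n E0 k0 (store m r i v) E \<longleftrightarrow> valid n E0 k0 m E"
  by (rule valid_cong) (auto simp: store_def)

text \<open>The potential of the reduction: every pass but the last fills a non-edge. This bounds
  the passes by a polynomial in \<open>n\<close> whatever the size of the parameter.\<close>

definition missing :: "nat \<Rightarrow> nat set set \<Rightarrow> nat" where
  "missing n E = card ([{..<n}]\<^bsup>2\<^esup> - E)"

lemma missing_insert:
  assumes "e \<in> [{..<n}]\<^bsup>2\<^esup> - E"
  shows "missing n (insert e E) < missing n E"
proof -
  have "finite ([{..<n}]\<^bsup>2\<^esup> - E)" by (simp add: finite_imp_finite_nsets)
  then show ?thesis unfolding missing_def by (rule psubset_card_mono) (use assms in blast)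
qed

text \<open>Uniqueness of division with remainder. It ensures that different entries of the matrix
  occupy different cells.\<close>

lemma index_inject:
  fixes i j n :: nat
  assumes "j < n" "j' < n"
  shows "i * n + j = i' * n + j' \<longleftrightarrow> i = i' \<and> j = j'"
proof
  assume eq: "i * n + j = i' * n + j'"
  then have "(i * n + j) div n = (i' * n + j') div n" "(i * n + j) mod n = (i' * n + j') mod n"
    by simp_all
  with assms show "i = i' \<and> j = j'" by simp
qed simp

lemma represents_insert:
  assumes "represents m n E" "a < n" "c < n"
  shows "represents (store (store m adjA (a * n + c) 1) adjA (c * n + a) 1) n (insert {a, c} E)"
proof -
  let ?m = "store (store m adjA (a * n + c) 1) adjA (c * n + a) 1"
  have adj: "?m adjA (i * n + j) = of_bool ({i, j} \<in> insert {a, c} E)" if ij: "i < n" "j < n" for i j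
  proof -
    have A: "?m adjA (i * n + j) = (if i = c \<and> j = a \<or> i = a \<and> j = c then 1 else m adjA (i * n + j))"
    proof -
      have "i * n + j = a * n + c \<longleftrightarrow> i = a \<and> j = c" "i * n + j = c * n + a \<longleftrightarrow> i = c \<and> j = a"
        using assms(2,3) ij by (intro index_inject; simp)+
      then show ?thesis unfolding store_apply by metis
    qed
    have B: "m adjA (i * n + j) = of_bool ({i, j} \<in> E)"
      using assms(1) ij by (simp add: represents_def)
    have C: "{i, j} = {a, c} \<longleftrightarrow> i = c \<and> j = a \<or> i = a \<and> j = c"
      unfolding doubleton_eq_iff by blast
    have D: "(if P then 1 else of_bool R) = (of_bool (P \<or> R) :: nat)" for P R by simp
    show ?thesis unfolding A B insert_iff C by (rule D)
  qed
  have other: "?m nReg = m nReg" "?m rowA = m rowA" by (simp_all add: store_def)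
  show ?thesis unfolding represents_def other
    using assms(1)[unfolded represents_def] adj by blast
qed

text \<open>The state inside a pass that began with \<open>v\<close> missing edges, \<open>P\<close>
  being the pairs examined so far. As long as nothing has changed, these pairs are known not to be
  forced. After a change nothing is claimed about them, because a new edge can alter earlier
  counts.\<close>

definition progress :: "nat \<Rightarrow> nat set set \<Rightarrow> nat \<Rightarrow> nat \<Rightarrow> (nat \<times> nat) set \<Rightarrow> memory \<Rightarrow> bool" where
  "progress n E0 k0 v P m \<longleftrightarrow> (\<exists>E. valid n E0 k0 m E \<and>
     (m chgReg 0 = 0 \<and> missing n E = v \<and>
        (m kReg 0 = 0 \<or> (\<forall>(a, c) \<in> P. card (partners E a c) \<le> 2 * m kReg 0)) \<or>
      m chgReg 0 = 1 \<and> missing n E < v))"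

lemma progress_store:
  "r \<notin> {nReg, adjA, rowA, kReg, chgReg} \<Longrightarrow> progress n E0 k0 v P (store m r i x) \<longleftrightarrow> progress n E0 k0 v P m"
  unfolding progress_def by (simp add: valid_store) (simp add: store_apply)

lemma wp_reduce_step:
  assumes n: "n \<le> B" and pr: "progress n E0 k0 v P m" and a: "m aReg 0 = a" "a < n"
    and c: "m cReg 0 = c" "c < n"
  shows "wp B reduce_step (\<lambda>(m', xs', ys'). xs' = xs \<and> ys' = ys \<and>
    progress n E0 k0 v (insert (a, c) P) m' \<and> m' aReg 0 = a \<and> m' cReg 0 = c) (m, xs, ys)"
proof -
  obtain E where val: "valid n E0 k0 m E" and E:
    "m chgReg 0 = 0 \<and> missing n E = v \<and>
        (m kReg 0 = 0 \<or> (\<forall>(a, c) \<in> P. card (partners E a c) \<le> 2 * m kReg 0)) \<or>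
      m chgReg 0 = 1 \<and> missing n E < v"
    using pr by (auto simp: progress_def)
  have rep: "represents m n E" and EV: "E \<subseteq> [{..<n}]\<^bsup>2\<^esup>" using val by (auto simp: valid_def)
  let ?m = "store m cntReg 0 0"
  have pre: "represents ?m n E \<and> ?m aReg 0 < n \<and> ?m cReg 0 < n"
    using rep a c by (simp add: represents_store) (simp add: store_apply)
  show ?thesis unfolding reduce_step_def
  proof (intro wp_Seq wp_Assign, simp only: aval.simps,
      rule wp_mono[OF counter_count_partners[OF n EV, unfolded counter_def, rule_format, OF pre]])
    fix s assume "case s of (m', xs', ys') \<Rightarrow> xs' = xs \<and> ys' = ys \<and> agree {cntReg, bReg, dReg} ?m m' \<and>
      m' cntReg 0 = ?m cntReg 0 + card (partners E (?m aReg 0) (?m cReg 0))"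
    then obtain m' where s: "s = (m', xs, ys)" and agr: "agree {cntReg, bReg, dReg} ?m m'"
      and cnt: "m' cntReg 0 = card (partners E a c)"
      using a c by (auto simp: store_apply)
    have eq: "m' x = m x" if "x \<notin> {cntReg, bReg, dReg}" for x
      using agreeD[OF agr that] that by (auto simp: store_def)
    have val': "valid n E0 k0 m' E" using val by (subst valid_cong[of _ m]) (auto simp: eq)
    have reg: "m' kReg 0 = m kReg 0" "m' chgReg 0 = m chgReg 0" "m' aReg 0 = a" "m' cReg 0 = c"
      using a c by (simp_all add: eq)
    have rep': "represents m' n E" using val' by (simp add: valid_def)
    have row: "m' rowA a = a * n" "m' rowA c = c * n" using rep' a c by (auto simp: represents_def)
    show "wp B (Cond (Conj (Less (Add (reg kReg) (reg kReg)) (reg cntReg)) (Less (Const 0) (reg kReg)))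
       (set_edge aReg cReg ;; set_edge cReg aReg ;;
        set_reg kReg (Sub (reg kReg) (Const 1)) ;; set_reg chgReg (Const 1))
       Skip) (\<lambda>(m', xs', ys'). xs' = xs \<and> ys' = ys \<and>
    progress n E0 k0 v (insert (a, c) P) m' \<and> m' aReg 0 = a \<and> m' cReg 0 = c) s"
      unfolding s
    proof (rule wp_Cond)
      assume "bval (Conj (Less (Add (reg kReg) (reg kReg)) (reg cntReg)) (Less (Const 0) (reg kReg)))
        (fst (m', xs, ys))"
      then have many: "2 * m kReg 0 < card (partners E a c)" and k: "0 < m kReg 0"
        using cnt reg by auto
      let ?e = "{a, c}"
      \<comment> \<open>A single partner already shows that \<open>a\<close> and \<open>c\<close>
        are distinct and non-adjacent, so the insertion really lowers
        \<open>missing\<close>.\<close>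
      have "partners E a c \<noteq> {}" using many by auto
      then have new: "?e \<in> [{..<n}]\<^bsup>2\<^esup> - E"
        using a c by (auto simp: partners_def obstruction_def nsets_def)
      define m1 where "m1 = store (store m' adjA (a * n + c) 1) adjA (c * n + a) 1"
      define m2 where "m2 = store (store m1 kReg 0 (m kReg 0 - 1)) chgReg 0 1"
      have "represents m2 n (insert ?e E)"
        unfolding m2_def m1_def using represents_insert[OF rep' a(2) c(2)] by (simp add: represents_store)
      moreover have k': "m2 kReg 0 = m kReg 0 - 1" by (simp add: m2_def store_apply)
      moreover have "TPC ({..<n}, E) (m kReg 0) \<longleftrightarrow> TPC ({..<n}, insert ?e E) (m kReg 0 - 1)"
        by (rule TPC_insert_forced[OF finite_lessThan EV many k])
      ultimately have "valid n E0 k0 m2 (insert ?e E)"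
        using val new EV by (auto simp: valid_def)
      moreover have "missing n (insert ?e E) < v" using missing_insert[OF new] E by auto
      moreover have "m2 chgReg 0 = 1" by (simp add: m2_def store_apply)
      ultimately have "progress n E0 k0 v (insert (a, c) P) m2" unfolding progress_def by blast
      moreover have "m2 aReg 0 = a \<and> m2 cReg 0 = c" using reg by (simp add: m2_def m1_def store_apply)
      ultimately show "wp B (set_edge aReg cReg ;; set_edge cReg aReg ;;
        set_reg kReg (Sub (reg kReg) (Const 1)) ;; set_reg chgReg (Const 1))
        (\<lambda>(m', xs', ys'). xs' = xs \<and> ys' = ys \<and>
          progress n E0 k0 v (insert (a, c) P) m' \<and> m' aReg 0 = a \<and> m' cReg 0 = c) (m', xs, ys)"
        unfolding set_edge_def
        by (intro wp_Seq wp_Assign) (simp add: m2_def m1_def store_apply reg row)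
    next
      assume "\<not> bval (Conj (Less (Add (reg kReg) (reg kReg)) (reg cntReg)) (Less (Const 0) (reg kReg)))
        (fst (m', xs, ys))"
      then have "m kReg 0 = 0 \<or> card (partners E a c) \<le> 2 * m kReg 0"
        using cnt reg by auto
      then have "progress n E0 k0 v (insert (a, c) P) m'"
        unfolding progress_def using val' E reg by (intro exI[of _ E]) auto
      then show "wp B Skip (\<lambda>(m', xs', ys'). xs' = xs \<and> ys' = ys \<and>
          progress n E0 k0 v (insert (a, c) P) m' \<and> m' aReg 0 = a \<and> m' cReg 0 = c) (m', xs, ys)"
        using reg by (intro wp_Skip) simp
    qed
  qed
qed

definition reduce_pass :: com where
  "reduce_pass = for_loop aReg nReg (for_loop cReg nReg reduce_step)"

lemma progress_n: "progress n E0 k0 v P m \<Longrightarrow> m nReg 0 = n"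
  by (auto simp: progress_def valid_def represents_def)

lemma wp_reduce_pass:
  assumes n: "n \<le> B" and pr: "progress n E0 k0 v {} m"
  shows "wp B reduce_pass (\<lambda>(m', xs', ys'). xs' = xs \<and> ys' = ys \<and>
    progress n E0 k0 v ({..<n} \<times> {..<n}) m') (m, xs, ys)"
  unfolding reduce_pass_def
proof (rule wp_for[where n = n and I = "\<lambda>i (m', xs', ys'). xs' = xs \<and> ys' = ys \<and>
    progress n E0 k0 v ({..<i} \<times> {..<n}) m' \<and> m' aReg 0 = i"])
  fix i m' xs' ys'
  assume i: "i < n" and "case (m', xs', ys') of (m', xs', ys') \<Rightarrow> xs' = xs \<and> ys' = ys \<and>
    progress n E0 k0 v ({..<i} \<times> {..<n}) m' \<and> m' aReg 0 = i"
  then have pr': "progress n E0 k0 v ({..<i} \<times> {..<n}) m'" and a: "m' aReg 0 = i"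
    and io: "xs' = xs" "ys' = ys" by auto
  show "wp B (for_loop cReg nReg reduce_step) (\<lambda>(m'', xs'', ys''). m'' aReg 0 = i \<and>
    (case (store m'' aReg 0 (Suc i), xs'', ys'') of (m', xs', ys') \<Rightarrow> xs' = xs \<and> ys' = ys \<and>
    progress n E0 k0 v ({..<Suc i} \<times> {..<n}) m' \<and> m' aReg 0 = Suc i)) (m', xs', ys')"
  \<comment> \<open>The pairs examined are the complete rows below \<open>i\<close> and the first
    \<open>j\<close> entries of row \<open>i\<close>.\<close>
  proof (rule wp_for[where n = n and I = "\<lambda>j (m', xs', ys'). xs' = xs \<and> ys' = ys \<and>
      progress n E0 k0 v ({..<i} \<times> {..<n} \<union> {i} \<times> {..<j}) m' \<and> m' aReg 0 = i \<and> m' cReg 0 = j"])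
    fix j m'' xs'' ys''
    assume j: "j < n" and "case (m'', xs'', ys'') of (m', xs', ys') \<Rightarrow> xs' = xs \<and> ys' = ys \<and>
      progress n E0 k0 v ({..<i} \<times> {..<n} \<union> {i} \<times> {..<j}) m' \<and> m' aReg 0 = i \<and> m' cReg 0 = j"
    then have pr'': "progress n E0 k0 v ({..<i} \<times> {..<n} \<union> {i} \<times> {..<j}) m''"
      and reg: "m'' aReg 0 = i" "m'' cReg 0 = j" and io: "xs'' = xs" "ys'' = ys" by auto
    have ins: "insert (i, j) ({..<i} \<times> {..<n} \<union> {i} \<times> {..<j}) = {..<i} \<times> {..<n} \<union> {i} \<times> {..<Suc j}"
      by auto
    show "wp B reduce_step (\<lambda>(m', xs', ys'). m' cReg 0 = j \<and>
      (case (store m' cReg 0 (Suc j), xs', ys') of (m', xs', ys') \<Rightarrow> xs' = xs \<and> ys' = ys \<and>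
      progress n E0 k0 v ({..<i} \<times> {..<n} \<union> {i} \<times> {..<Suc j}) m' \<and> m' aReg 0 = i \<and> m' cReg 0 = Suc j))
      (m'', xs'', ys'')"
      by (rule wp_mono[OF wp_reduce_step[OF n pr'' reg(1) i reg(2) j]])
        (auto simp: io ins progress_store store_apply)
  next
    fix s assume "case s of (m', xs', ys') \<Rightarrow> xs' = xs \<and> ys' = ys \<and>
      progress n E0 k0 v ({..<i} \<times> {..<n} \<union> {i} \<times> {..<n}) m' \<and> m' aReg 0 = i \<and> m' cReg 0 = n"
    moreover have "{..<i} \<times> {..<n} \<union> {i} \<times> {..<n} = {..<Suc i} \<times> {..<n}" by auto
    ultimately show "case s of (m'', xs'', ys'') \<Rightarrow> m'' aReg 0 = i \<and>
      (case (store m'' aReg 0 (Suc i), xs'', ys'') of (m', xs', ys') \<Rightarrow> xs' = xs \<and> ys' = ys \<and>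
      progress n E0 k0 v ({..<Suc i} \<times> {..<n}) m' \<and> m' aReg 0 = Suc i)"
      by (auto simp: progress_store store_apply)
  qed (use pr' a io n progress_n in \<open>auto simp: progress_store store_apply\<close>)
qed (use pr n progress_n in \<open>auto simp: progress_store store_apply\<close>)

text \<open>One pass is not enough: an added edge can create obstructions that force a pair examined
  before. Passes are repeated until one leaves the graph unchanged.\<close>

definition reduce :: com where
  "reduce = set_reg chgReg (Const 1) ;;
     While (Equal (reg chgReg) (Const 1)) (set_reg chgReg (Const 0) ;; reduce_pass)"

text \<open>Exactly what \<open>card_core_le\<close> asks of the current parameter and
  graph.\<close>

definition reduced :: "nat \<Rightarrow> nat set set \<Rightarrow> bool" where
  "reduced k E \<longleftrightarrow> k = 0 \<or> (\<forall>a c. card (partners E a c) \<le> 2 * k)"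

lemma reducedI:
  assumes E: "E \<subseteq> [{..<n}]\<^bsup>2\<^esup>"
    and "k = 0 \<or> (\<forall>(a, c) \<in> {..<n} \<times> {..<n}. card (partners E a c) \<le> 2 * k)"
  shows "reduced k E"
proof -
  have "card (partners E a c) \<le> 2 * k" if "k \<noteq> 0" for a c
  proof (cases "a < n \<and> c < n")
    case True
    then show ?thesis using assms(2) that by auto
  next
    case False
    then have "partners E a c = {}" using obstruction_verts[OF E] by (auto simp: partners_def)
    then show ?thesis by simp
  qed
  then show ?thesis by (auto simp: reduced_def)
qed

lemma wp_reduce:
  assumes n: "n \<le> B" and val: "valid n E0 k0 m E" and B: "missing n E < B"
  shows "wp B reduce (\<lambda>(m', xs', ys'). xs' = xs \<and> ys' = ys \<and>
    (\<exists>E. valid n E0 k0 m' E \<and> reduced (m' kReg 0) E)) (m, xs, ys)"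
  unfolding reduce_def
\<comment> \<open>The variant is \<open>missing n E + 1\<close> while another pass is due and
  \<open>missing n E\<close> afterwards. The extra 1 pays for the last pass, which adds no
  edge.\<close>
proof (rule wp_Seq, rule wp_Assign,
    rule wp_While[where v = "missing n E + 1" and I = "\<lambda>v (m', xs', ys'). xs' = xs \<and> ys' = ys \<and>
    (\<exists>E. valid n E0 k0 m' E \<and> (m' chgReg 0 = 1 \<and> v = missing n E + 1 \<or>
      m' chgReg 0 = 0 \<and> v = missing n E \<and> reduced (m' kReg 0) E))"])
  fix v s
  assume "case s of (m', xs', ys') \<Rightarrow> xs' = xs \<and> ys' = ys \<and>
    (\<exists>E. valid n E0 k0 m' E \<and> (m' chgReg 0 = 1 \<and> v = missing n E + 1 \<or>
      m' chgReg 0 = 0 \<and> v = missing n E \<and> reduced (m' kReg 0) E))"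
  then obtain m' E where s: "s = (m', xs, ys)" and val: "valid n E0 k0 m' E"
    and E: "m' chgReg 0 = 1 \<and> v = missing n E + 1 \<or>
      m' chgReg 0 = 0 \<and> v = missing n E \<and> reduced (m' kReg 0) E" by auto
  { assume "bval (Equal (reg chgReg) (Const 1)) (fst s)"
    then have v: "v = missing n E + 1" using E s by auto
    let ?m = "store m' chgReg 0 0"
    have pr: "progress n E0 k0 (missing n E) {} ?m"
      unfolding progress_def by (intro exI[of _ E]) (simp add: valid_store val, simp add: store_apply)
    show "wp B (set_reg chgReg (Const 0) ;; reduce_pass) (\<lambda>s'. \<exists>v'<v. case s' of (m', xs', ys') \<Rightarrow>
      xs' = xs \<and> ys' = ys \<and> (\<exists>E. valid n E0 k0 m' E \<and> (m' chgReg 0 = 1 \<and> v' = missing n E + 1 \<or>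
      m' chgReg 0 = 0 \<and> v' = missing n E \<and> reduced (m' kReg 0) E))) s"
      unfolding s
    proof (rule wp_Seq, rule wp_Assign, simp only: aval.simps, rule wp_mono[OF wp_reduce_pass[OF n pr]])
      fix s' assume "case s' of (m', xs', ys') \<Rightarrow> xs' = xs \<and> ys' = ys \<and>
        progress n E0 k0 (missing n E) ({..<n} \<times> {..<n}) m'"
      then obtain m'' where s': "s' = (m'', xs, ys)"
        and pr': "progress n E0 k0 (missing n E) ({..<n} \<times> {..<n}) m''" by auto
      then obtain E' where val': "valid n E0 k0 m'' E'" and E': "m'' chgReg 0 = 0 \<and> missing n E' = missing n E \<and>
        (m'' kReg 0 = 0 \<or> (\<forall>(a, c) \<in> {..<n} \<times> {..<n}. card (partners E' a c) \<le> 2 * m'' kReg 0)) \<or>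
        m'' chgReg 0 = 1 \<and> missing n E' < missing n E" unfolding progress_def by blast
      from E' show "\<exists>v'<v. case s' of (m', xs', ys') \<Rightarrow>
        xs' = xs \<and> ys' = ys \<and> (\<exists>E. valid n E0 k0 m' E \<and> (m' chgReg 0 = 1 \<and> v' = missing n E + 1 \<or>
        m' chgReg 0 = 0 \<and> v' = missing n E \<and> reduced (m' kReg 0) E))"
      proof
        assume *: "m'' chgReg 0 = 0 \<and> missing n E' = missing n E \<and>
        (m'' kReg 0 = 0 \<or> (\<forall>(a, c) \<in> {..<n} \<times> {..<n}. card (partners E' a c) \<le> 2 * m'' kReg 0))"
        then have "reduced (m'' kReg 0) E'" using reducedI val' by (auto simp: valid_def)
        then show ?thesis using * val' s' v by (intro exI[of _ "missing n E"]) auto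
      next
        assume "m'' chgReg 0 = 1 \<and> missing n E' < missing n E"
        then show ?thesis using val' s' v by (intro exI[of _ "missing n E' + 1"]) auto
      qed
    qed }
  { assume "\<not> bval (Equal (reg chgReg) (Const 1)) (fst s)"
    then have "reduced (m' kReg 0) E" using E s by auto
    then show "case s of (m', xs', ys') \<Rightarrow> xs' = xs \<and> ys' = ys \<and>
      (\<exists>E. valid n E0 k0 m' E \<and> reduced (m' kReg 0) E)" using val s by auto }
next
  show "case (store m chgReg (aval (Const 0) m) (aval (Const 1) m), xs, ys) of (m', xs', ys') \<Rightarrow>
    xs' = xs \<and> ys' = ys \<and> (\<exists>E'. valid n E0 k0 m' E' \<and>
    (m' chgReg 0 = 1 \<and> missing n E + 1 = missing n E' + 1 \<or>
      m' chgReg 0 = 0 \<and> missing n E + 1 = missing n E' \<and> reduced (m' kReg 0) E'))"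
    using val by (auto simp: valid_store store_apply intro!: exI[of _ E])
qed (use B in simp)

section \<open>Listing the core and comparing its size with the bound\<close>

definition collect_core :: com where
  "collect_core = set_reg mReg (Const 0) ;; for_loop aReg nReg
     (set_reg cntReg (Const 0) ;; count_core ;;
      Cond (Less (Const 0) (reg cntReg))
        (Assign listA (reg mReg) (reg aReg) ;; increment mReg) Skip)"

definition stores_list :: "memory \<Rightarrow> nat list \<Rightarrow> bool" where
  "stores_list m ls \<longleftrightarrow> m mReg 0 = length ls \<and> (\<forall>i<length ls. m listA i = ls ! i)"

lemma wp_collect_core:
  assumes n: "n \<le> B" and val: "valid n E0 k0 m E" and k: "m kReg 0 = k"
  shows "wp B collect_core (\<lambda>(m', xs', ys'). xs' = xs \<and> ys' = ys \<and> valid n E0 k0 m' E \<and>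
    m' kReg 0 = k \<and> stores_list m' (filter (\<lambda>v. v \<in> core E) [0..<n])) (m, xs, ys)"
  unfolding collect_core_def
proof (rule wp_Seq, rule wp_Assign,
    rule wp_for[where n = n and I = "\<lambda>i (m', xs', ys'). xs' = xs \<and> ys' = ys \<and> valid n E0 k0 m' E \<and>
    m' kReg 0 = k \<and> stores_list m' (filter (\<lambda>v. v \<in> core E) [0..<i]) \<and> m' aReg 0 = i"])
  let ?ls = "\<lambda>i. filter (\<lambda>v. v \<in> core E) [0..<i]"
  fix i m' xs' ys'
  assume i: "i < n" and "case (m', xs', ys') of (m', xs', ys') \<Rightarrow> xs' = xs \<and> ys' = ys \<and>
    valid n E0 k0 m' E \<and> m' kReg 0 = k \<and> stores_list m' (?ls i) \<and> m' aReg 0 = i"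
  then have io: "xs' = xs" "ys' = ys" and val': "valid n E0 k0 m' E" and k': "m' kReg 0 = k"
    and ls: "stores_list m' (?ls i)" and a: "m' aReg 0 = i" by auto
  have rep: "represents m' n E" and EV: "E \<subseteq> [{..<n}]\<^bsup>2\<^esup>" using val' by (auto simp: valid_def)
  obtain f where f: "counter B {bReg, cReg, dReg} cntReg count_core
      (\<lambda>m. represents m n E \<and> m aReg 0 < n) f"
    and f_pos: "\<And>m. represents m n E \<Longrightarrow> 0 < f m \<longleftrightarrow> m aReg 0 \<in> core E"
    using counter_count_core[OF n EV] by blast
  let ?m = "store m' cntReg 0 0"
  have rep': "represents ?m n E" using rep by (simp add: represents_store)
  have pre: "represents ?m n E \<and> ?m aReg 0 < n" using rep' a i by (simp add: store_apply)
  show "wp B (set_reg cntReg (Const 0) ;; count_core ;;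
      Cond (Less (Const 0) (reg cntReg)) (Assign listA (reg mReg) (reg aReg) ;; increment mReg) Skip)
    (\<lambda>(m'', xs'', ys''). m'' aReg 0 = i \<and>
      (case (store m'' aReg 0 (Suc i), xs'', ys'') of (m', xs', ys') \<Rightarrow> xs' = xs \<and> ys' = ys \<and>
      valid n E0 k0 m' E \<and> m' kReg 0 = k \<and> stores_list m' (?ls (Suc i)) \<and> m' aReg 0 = Suc i))
    (m', xs', ys')"
  proof (rule wp_Seq, rule wp_Assign, simp only: aval.simps, rule wp_Seq,
      rule wp_mono[OF f[unfolded counter_def, rule_format, OF pre]])
    fix s assume "case s of (m'', xs'', ys'') \<Rightarrow> xs'' = xs' \<and> ys'' = ys' \<and>
      agree {cntReg, bReg, cReg, dReg} ?m m'' \<and> m'' cntReg 0 = ?m cntReg 0 + f ?m"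
    then obtain m'' where s: "s = (m'', xs, ys)" and agr: "agree {cntReg, bReg, cReg, dReg} ?m m''"
      and cnt: "m'' cntReg 0 = f ?m" using io by (auto simp: store_apply)
    have eq: "m'' x = m' x" if "x \<notin> {cntReg, bReg, cReg, dReg}" for x
      using agreeD[OF agr that] that by (auto simp: store_def)
    have val'': "valid n E0 k0 m'' E" using val' by (subst valid_cong[of _ m']) (auto simp: eq)
    have ls'': "stores_list m'' (?ls i)" using ls by (simp add: stores_list_def eq)
    have pos: "0 < m'' cntReg 0 \<longleftrightarrow> i \<in> core E"
      using f_pos[OF rep'] cnt a by (simp add: store_apply)
    show "wp B (Cond (Less (Const 0) (reg cntReg)) (Assign listA (reg mReg) (reg aReg) ;; increment mReg) Skip)
      (\<lambda>(m'', xs'', ys''). m'' aReg 0 = i \<and>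
      (case (store m'' aReg 0 (Suc i), xs'', ys'') of (m', xs', ys') \<Rightarrow> xs' = xs \<and> ys' = ys \<and>
      valid n E0 k0 m' E \<and> m' kReg 0 = k \<and> stores_list m' (?ls (Suc i)) \<and> m' aReg 0 = Suc i)) s"
      unfolding s
    proof (rule wp_Cond)
      assume "bval (Less (Const 0) (reg cntReg)) (fst (m'', xs, ys))"
      then have "i \<in> core E" using pos by simp
      then show "wp B (Assign listA (reg mReg) (reg aReg) ;; increment mReg)
        (\<lambda>(m'', xs'', ys''). m'' aReg 0 = i \<and>
        (case (store m'' aReg 0 (Suc i), xs'', ys'') of (m', xs', ys') \<Rightarrow> xs' = xs \<and> ys' = ys \<and>
        valid n E0 k0 m' E \<and> m' kReg 0 = k \<and> stores_list m' (?ls (Suc i)) \<and> m' aReg 0 = Suc i))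
        (m'', xs, ys)"
        unfolding increment_def using ls'' val'' k' a
        by (intro wp_Seq wp_Assign)
          (simp add: valid_store stores_list_def, simp add: store_apply eq nth_append)
    next
      assume "\<not> bval (Less (Const 0) (reg cntReg)) (fst (m'', xs, ys))"
      then have "i \<notin> core E" using pos by simp
      then show "wp B Skip
        (\<lambda>(m'', xs'', ys''). m'' aReg 0 = i \<and>
        (case (store m'' aReg 0 (Suc i), xs'', ys'') of (m', xs', ys') \<Rightarrow> xs' = xs \<and> ys' = ys \<and>
        valid n E0 k0 m' E \<and> m' kReg 0 = k \<and> stores_list m' (?ls (Suc i)) \<and> m' aReg 0 = Suc i))
        (m'', xs, ys)"
        using ls'' val'' k' a
        by (intro wp_Skip) (simp add: valid_store stores_list_def, simp add: store_apply eq)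
    qed
  qed
qed (use val k n in \<open>auto simp: valid_store stores_list_def store_apply valid_def represents_def\<close>)

text \<open>
  The square of \<open>k\<close> is only needed for a comparison with a number \<open>\<le> n\<close>. Stopping as soon as the partial
  sum exceeds \<open>n\<close> matters: \<open>k\<close> may be exponential in the input length.
\<close>

definition square :: com where
  "square = set_reg sqReg (Const 0) ;; set_reg iReg (Const 0) ;;
     While (Conj (Less (reg iReg) (reg kReg)) (Less (reg sqReg) (Add (reg nReg) (Const 1))))
       (set_reg sqReg (Add (reg sqReg) (reg kReg)) ;; increment iReg)"

text \<open>A premature result exceeds \<open>n\<close> and hence the size of the core, as the true
  square then does too; the later comparison has the same outcome for both.\<close>

lemma wp_square:
  assumes B: "n < B" and m: "m nReg 0 = n" "m kReg 0 = k"
  shows "wp B square (\<lambda>(m', xs', ys'). xs' = xs \<and> ys' = ys \<and> agree {sqReg, iReg} m m' \<and>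
    (m' sqReg 0 = k * k \<or> n < m' sqReg 0 \<and> m' sqReg 0 \<le> k * k)) (m, xs, ys)"
  unfolding square_def
proof (rule wp_Seq, rule wp_Assign, rule wp_Seq, rule wp_Assign,
    rule wp_While[where v = "n + 1" and I = "\<lambda>v (m', xs', ys'). xs' = xs \<and> ys' = ys \<and>
      agree {sqReg, iReg} m m' \<and> m' iReg 0 \<le> k \<and> m' sqReg 0 = m' iReg 0 * k \<and> v = n + 1 - m' sqReg 0"])
  fix v s
  assume "case s of (m', xs', ys') \<Rightarrow> xs' = xs \<and> ys' = ys \<and>
    agree {sqReg, iReg} m m' \<and> m' iReg 0 \<le> k \<and> m' sqReg 0 = m' iReg 0 * k \<and> v = n + 1 - m' sqReg 0"
  then obtain m' where s: "s = (m', xs, ys)" and agr: "agree {sqReg, iReg} m m'"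
    and inv: "m' iReg 0 \<le> k" "m' sqReg 0 = m' iReg 0 * k" "v = n + 1 - m' sqReg 0" by auto
  have reg: "m' kReg 0 = k" "m' nReg 0 = n" using agreeD[OF agr] m by simp_all
  { assume "bval (Conj (Less (reg iReg) (reg kReg)) (Less (reg sqReg) (Add (reg nReg) (Const 1)))) (fst s)"
    then have lt: "m' iReg 0 < k" "m' sqReg 0 < n + 1" using s reg by auto
    \<comment> \<open>Since \<open>iReg\<close> is below \<open>k\<close>, \<open>k\<close> is
      positive and the partial sum grows. The guard keeps it at most \<open>n\<close>, so the
      truncated difference strictly drops.\<close>
    have "n + 1 - (m' sqReg 0 + k) < v" using lt inv by linarith
    moreover have "agree {sqReg, iReg} m (store (store m' sqReg 0 x) iReg 0 y)" for x y
      using agr by (auto simp: agree_def store_def)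
    ultimately show "wp B (set_reg sqReg (Add (reg sqReg) (reg kReg)) ;; increment iReg)
      (\<lambda>s'. \<exists>v'<v. case s' of (m', xs', ys') \<Rightarrow> xs' = xs \<and> ys' = ys \<and>
      agree {sqReg, iReg} m m' \<and> m' iReg 0 \<le> k \<and> m' sqReg 0 = m' iReg 0 * k \<and> v' = n + 1 - m' sqReg 0) s"
      unfolding s increment_def using lt(1) inv(2)
      by (intro wp_Seq wp_Assign) (simp, simp add: store_apply reg) }
  { assume "\<not> bval (Conj (Less (reg iReg) (reg kReg)) (Less (reg sqReg) (Add (reg nReg) (Const 1)))) (fst s)"
    then have "m' iReg 0 = k \<or> n < m' sqReg 0" using s reg inv(1) by auto
    moreover have "m' sqReg 0 \<le> k * k" using inv by simp
    ultimately show "case s of (m', xs', ys') \<Rightarrow> xs' = xs \<and> ys' = ys \<and> agree {sqReg, iReg} m m' \<and>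
      (m' sqReg 0 = k * k \<or> n < m' sqReg 0 \<and> m' sqReg 0 \<le> k * k)"
      using s agr inv(2) by auto }
qed (use B in \<open>auto simp: agree_def store_def\<close>)

section \<open>Writing the output\<close>

definition double :: "aexp \<Rightarrow> aexp" where
  "double e = Add e e"

text \<open>Straight-line code for a fixed string, used for the constant no-instance. As
  \<open>Write\<close> takes a test, a bit is given as a comparison of constants.\<close>

definition write_bits :: "bool list \<Rightarrow> com" where
  "write_bits bs = foldr (\<lambda>b c. Write (if b then Equal (Const 0) (Const 0) else Less (Const 0) (Const 0)) ;; c) bs Skip"

lemma wp_write_bits: "Q (m, xs, ys @ bs) \<Longrightarrow> wp B (write_bits bs) Q (m, xs, ys)"
proof (induction bs arbitrary: ys)
  case Nil
  then show ?case by (auto simp: write_bits_def intro: wp_Skip)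
next
  case (Cons b bs)
  then have "wp B (write_bits bs) Q (m, xs, ys @ [b])" by simp
  then show ?case by (auto simp: write_bits_def intro!: wp_Seq wp_Write)
qed

text \<open>The most significant bit comes first and there is no division. So the powers of two up
  to the first one above \<open>k\<close> are tabulated by doubling, and then, in descending order,
  each power that fits is subtracted.\<close>

definition write_binary :: com where
  "write_binary = set_reg iReg (Const 0) ;; Assign powA (Const 0) (Const 1) ;;
     While (Neg (Less (reg kReg) (Cell powA (reg iReg))))
       (Assign powA (Add (reg iReg) (Const 1)) (double (Cell powA (reg iReg))) ;; increment iReg) ;;
     While (Less (Const 0) (reg iReg))
       (set_reg iReg (Sub (reg iReg) (Const 1)) ;;
        Write (Neg (Less (reg kReg) (Cell powA (reg iReg)))) ;;
        Cond (Less (reg kReg) (Cell powA (reg iReg))) Skip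
          (set_reg kReg (Sub (reg kReg) (Cell powA (reg iReg)))))"

lemma binary_0: "binary 0 = []"
  by (simp add: binary.simps)

lemma binary_pos: "0 < k \<Longrightarrow> binary k = binary (k div 2) @ [odd k]"
  by (subst binary.simps) simp

lemma less_two_power_length_binary: "k < 2 ^ length (binary k)"
proof (induction k rule: less_induct)
  case (less k)
  show ?case
  proof (cases "k = 0")
    case False
    then have "k div 2 < 2 ^ length (binary (k div 2))" using less by simp
    then have "k < 2 * 2 ^ length (binary (k div 2))" by linarith
    then show ?thesis using False by (simp add: binary_pos)
  qed simp
qed

text \<open>The loops that write the new parameter, which is at most the old one, are thereby
  bounded by the input length.\<close>

lemma length_binary_mono: "j \<le> k \<Longrightarrow> length (binary j) \<le> length (binary k)"
proof (induction k arbitrary: j rule: less_induct)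
  case (less k)
  show ?case
  proof (cases "j = 0")
    case True
    then show ?thesis by (simp add: binary_0)
  next
    case False
    then have "length (binary (j div 2)) \<le> length (binary (k div 2))"
      using less by (simp add: div_le_mono)
    then show ?thesis using False less.prems by (simp add: binary_pos)
  qed
qed

lemma wp_write_binary:
  assumes k: "m kReg 0 = k" and B: "length (binary k) < B"
  shows "wp B write_binary (\<lambda>(m', xs', ys'). xs' = xs \<and> ys' = ys @ binary k) (m, xs, ys)"
proof -
  let ?L = "length (binary k)"
  have 2: "wp B (While (Less (Const 0) (reg iReg))
       (set_reg iReg (Sub (reg iReg) (Const 1)) ;;
        Write (Neg (Less (reg kReg) (Cell powA (reg iReg)))) ;;
        Cond (Less (reg kReg) (Cell powA (reg iReg))) Skip
          (set_reg kReg (Sub (reg kReg) (Cell powA (reg iReg))))))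
      (\<lambda>(m', xs', ys'). xs' = xs \<and> ys' = ys @ binary k) (m, xs, ys)"
    if m: "m kReg 0 = k" "\<forall>j \<le> m iReg 0. m powA j = 2 ^ j" "k < 2 ^ m iReg 0"
      "\<forall>j < m iReg 0. 2 ^ j \<le> k" "m iReg 0 \<le> ?L" for m
  \<comment> \<open>The bits from position \<open>v\<close> upwards have been written, and
    \<open>kReg\<close> holds the remainder. Initially the quotient is 0 and its representation is
    empty. The conjunct \<open>2 ^ j \<le> k\<close> keeps later quotients positive, so each step
    appends exactly one bit and no leading zero.\<close>
  proof (rule wp_While[where v = "m iReg 0" and I = "\<lambda>v (m, xs', ys'). xs' = xs \<and> v = m iReg 0 \<and>
      m kReg 0 = k mod 2 ^ v \<and> ys' = ys @ binary (k div 2 ^ v) \<and> (\<forall>j < v. m powA j = 2 ^ j \<and> 2 ^ j \<le> k)"])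
    show "case (m, xs, ys) of (m', xs', ys') \<Rightarrow> xs' = xs \<and> m iReg 0 = m' iReg 0 \<and>
      m' kReg 0 = k mod 2 ^ m iReg 0 \<and> ys' = ys @ binary (k div 2 ^ m iReg 0) \<and>
      (\<forall>j < m iReg 0. m' powA j = 2 ^ j \<and> 2 ^ j \<le> k)"
      using m by (simp add: binary_0)
    show "m iReg 0 \<le> B" using m B by simp
  next
    fix v s
    assume "case s of (m, xs', ys') \<Rightarrow> xs' = xs \<and> v = m iReg 0 \<and> m kReg 0 = k mod 2 ^ v \<and>
      ys' = ys @ binary (k div 2 ^ v) \<and> (\<forall>j < v. m powA j = 2 ^ j \<and> 2 ^ j \<le> k)"
    then obtain m where s: "s = (m, xs, ys @ binary (k div 2 ^ v))" and i: "m iReg 0 = v"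
      and r: "m kReg 0 = k mod 2 ^ v" and pow: "\<And>j. j < v \<Longrightarrow> m powA j = 2 ^ j \<and> 2 ^ j \<le> k" by auto
    { assume "bval (Less (Const 0) (reg iReg)) (fst s)"
      then obtain w where v: "v = Suc w" using s i by (cases v) auto
      have pw: "m powA w = 2 ^ w" "2 ^ w \<le> k" using pow[of w] v by auto
      have "0 < k div 2 ^ w" using pw(2) by (simp add: div_greater_zero_iff)
      moreover have "k div 2 ^ v = k div 2 ^ w div 2"
        unfolding v power_Suc2 by (rule div_mult2_eq)
      ultimately have bin: "binary (k div 2 ^ w) = binary (k div 2 ^ v) @ [odd (k div 2 ^ w)]"
        using binary_pos by metis
      have split: "k mod 2 ^ v = 2 ^ w * (k div 2 ^ w mod 2) + k mod 2 ^ w"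
        unfolding v power_Suc2 by (rule mod_mult2_eq)
      have odd: "odd (k div 2 ^ w) \<longleftrightarrow> \<not> k mod 2 ^ v < 2 ^ w"
        unfolding split by (cases "odd (k div 2 ^ w)") (auto simp: odd_iff_mod_2_eq_one even_iff_mod_2_eq_zero)
      have rest: "k mod 2 ^ w = (if k mod 2 ^ v < 2 ^ w then k mod 2 ^ v else k mod 2 ^ v - 2 ^ w)"
        using odd split by (auto simp: odd_iff_mod_2_eq_one even_iff_mod_2_eq_zero)
      show "wp B (set_reg iReg (Sub (reg iReg) (Const 1)) ;;
        Write (Neg (Less (reg kReg) (Cell powA (reg iReg)))) ;;
        Cond (Less (reg kReg) (Cell powA (reg iReg))) Skip
          (set_reg kReg (Sub (reg kReg) (Cell powA (reg iReg)))))
        (\<lambda>s'. \<exists>v'<v. case s' of (m, xs', ys') \<Rightarrow> xs' = xs \<and> v' = m iReg 0 \<and>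
          m kReg 0 = k mod 2 ^ v' \<and> ys' = ys @ binary (k div 2 ^ v') \<and>
          (\<forall>j < v'. m powA j = 2 ^ j \<and> 2 ^ j \<le> k)) s"
        unfolding s
        by (intro wp_Seq wp_Assign wp_Write wp_Cond wp_Skip exI[of _ w])
          (use v pow in \<open>simp_all add: store_apply i r pw bin odd rest\<close>) }
    { assume "\<not> bval (Less (Const 0) (reg iReg)) (fst s)"
      then show "case s of (m', xs', ys') \<Rightarrow> xs' = xs \<and> ys' = ys @ binary k" using s i by simp }
  qed
  show ?thesis unfolding write_binary_def
  proof (rule wp_Seq, rule wp_Assign, rule wp_Seq, rule wp_Assign, rule wp_Seq,
      rule wp_While[where v = "?L" and I = "\<lambda>v (m', xs', ys'). xs' = xs \<and> ys' = ys \<and>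
      m' kReg 0 = k \<and> (\<forall>j \<le> m' iReg 0. m' powA j = 2 ^ j) \<and> (\<forall>j < m' iReg 0. 2 ^ j \<le> k) \<and>
      m' iReg 0 \<le> ?L \<and> v = ?L - m' iReg 0"])
    fix v s
    assume "case s of (m', xs', ys') \<Rightarrow> xs' = xs \<and> ys' = ys \<and>
      m' kReg 0 = k \<and> (\<forall>j \<le> m' iReg 0. m' powA j = 2 ^ j) \<and> (\<forall>j < m' iReg 0. 2 ^ j \<le> k) \<and>
      m' iReg 0 \<le> ?L \<and> v = ?L - m' iReg 0"
    then obtain m' where s: "s = (m', xs, ys)" and m': "m' kReg 0 = k"
      "\<forall>j \<le> m' iReg 0. m' powA j = 2 ^ j" "\<forall>j < m' iReg 0. 2 ^ j \<le> k"
      "m' iReg 0 \<le> ?L" "v = ?L - m' iReg 0" by auto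
    { assume "bval (Neg (Less (reg kReg) (Cell powA (reg iReg)))) (fst s)"
      then have le: "2 ^ m' iReg 0 \<le> k" using s m' by simp
      \<comment> \<open>Comparing exponents in \<open>2 ^ i \<le> k < 2 ^ L\<close> bounds the
        number of doublings by the bit length.\<close>
      then have "(2::nat) ^ m' iReg 0 < 2 ^ ?L"
        using less_two_power_length_binary[of k] by (rule order_le_less_trans)
      then have lt: "m' iReg 0 < ?L" by simp
      show "wp B (Assign powA (Add (reg iReg) (Const 1)) (double (Cell powA (reg iReg))) ;; increment iReg)
        (\<lambda>s'. \<exists>v'<v. case s' of (m', xs', ys') \<Rightarrow> xs' = xs \<and> ys' = ys \<and>
          m' kReg 0 = k \<and> (\<forall>j \<le> m' iReg 0. m' powA j = 2 ^ j) \<and> (\<forall>j < m' iReg 0. 2 ^ j \<le> k) \<and>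
          m' iReg 0 \<le> ?L \<and> v' = ?L - m' iReg 0) s"
        unfolding s increment_def double_def
        by (intro wp_Seq wp_Assign exI[of _ "?L - Suc (m' iReg 0)"])
          (use m' le lt in \<open>auto simp: store_apply le_Suc_eq less_Suc_eq\<close>) }
    { assume "\<not> bval (Neg (Less (reg kReg) (Cell powA (reg iReg)))) (fst s)"
      then have "k < 2 ^ m' iReg 0" using s m' by simp
      then show "wp B (While (Less (Const 0) (reg iReg))
       (set_reg iReg (Sub (reg iReg) (Const 1)) ;;
        Write (Neg (Less (reg kReg) (Cell powA (reg iReg)))) ;;
        Cond (Less (reg kReg) (Cell powA (reg iReg))) Skip
          (set_reg kReg (Sub (reg kReg) (Cell powA (reg iReg))))))
        (\<lambda>(m', xs', ys'). xs' = xs \<and> ys' = ys @ binary k) s"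
        unfolding s using m' by (intro 2) }
  qed (use k B in \<open>auto simp: store_apply\<close>)
qed

text \<open>The relabelled graph is never built in memory: its entries are looked up in the old
  matrix through the list of core vertices.\<close>

definition write_matrix :: com where
  "write_matrix = for_loop aReg mReg (for_loop cReg mReg
     (Write (edge_test (Cell listA (reg aReg)) (Cell listA (reg cReg)))))"

definition write_instance :: com where
  "write_instance = for_loop iReg mReg (Write (Equal (Const 0) (Const 0))) ;;
     Write (Less (Const 0) (Const 0)) ;; write_matrix ;; write_binary"

definition relabelled :: "nat list \<Rightarrow> nat set set \<Rightarrow> nat graph" where
  "relabelled ls E = ({..<length ls},
     {{i, j} | i j. i < length ls \<and> j < length ls \<and> {ls ! i, ls ! j} \<in> E})"

lemma encode_relabelled:
  "encode (relabelled ls E, k) = replicate (length ls) True @ [False] @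
     concat (map (\<lambda>i. map (\<lambda>j. {ls ! i, ls ! j} \<in> E) [0..<length ls]) [0..<length ls]) @ binary k"
proof -
  have "{i, j} \<in> edges (relabelled ls E) \<longleftrightarrow> {ls ! i, ls ! j} \<in> E"
    if "i < length ls" "j < length ls" for i j
    using that by (auto simp: relabelled_def doubleton_eq_iff insert_commute)
  then have *: "map (\<lambda>i. map (\<lambda>j. {i, j} \<in> edges (relabelled ls E)) [0..<length ls]) [0..<length ls]
      = map (\<lambda>i. map (\<lambda>j. {ls ! i, ls ! j} \<in> E) [0..<length ls]) [0..<length ls]"
    by (intro map_cong refl) auto
  have "card (verts (relabelled ls E)) = length ls" by (simp add: relabelled_def)
  then show ?thesis by (simp only: encode_def prod.case Let_def *)
qed

lemma writer_cong:
  assumes "writer B R c pre f" "\<And>m. pre m \<Longrightarrow> f m = g m"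
  shows "writer B R c pre g"
  using assms unfolding writer_def by simp

lemma writer_write_matrix:
  assumes ls: "length ls \<le> B" "set ls \<subseteq> {..<n}"
  shows "writer B {aReg, cReg} write_matrix (\<lambda>m. represents m n E \<and> stores_list m ls)
    (\<lambda>m. concat (map (\<lambda>i. map (\<lambda>j. {ls ! i, ls ! j} \<in> E) [0..<length ls]) [0..<length ls]))"
proof -
  have bit: "bval (edge_test (Cell listA (reg aReg)) (Cell listA (reg cReg))) m \<longleftrightarrow>
      {ls ! (m aReg 0), ls ! (m cReg 0)} \<in> E"
    if "represents m n E" "stores_list m ls" "m aReg 0 < length ls" "m cReg 0 < length ls" for m
  proof -
    have "ls ! i < n" if "i < length ls" for i using that ls(2) nth_mem by blast
    with that bval_edge_test[OF that(1), of "Cell listA (reg aReg)" "Cell listA (reg cReg)"]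
    show ?thesis by (simp add: stores_list_def)
  qed
  have 1: "writer B {} (Write (edge_test (Cell listA (reg aReg)) (Cell listA (reg cReg))))
    (\<lambda>m. represents m n E \<and> stores_list m ls \<and> m aReg 0 < length ls \<and> m cReg 0 < length ls)
    (\<lambda>m. [{ls ! (m aReg 0), ls ! (m cReg 0)} \<in> E])"
    unfolding writer_def by (auto intro!: wp_Write simp: bit agree_refl)
  have 2: "writer B {cReg} (for_loop cReg mReg (Write (edge_test (Cell listA (reg aReg)) (Cell listA (reg cReg)))))
    (\<lambda>m. represents m n E \<and> stores_list m ls \<and> m aReg 0 < length ls)
    (\<lambda>m. map (\<lambda>j. {ls ! (m aReg 0), ls ! j} \<in> E) [0..<m mReg 0])"
    by (rule writer_cong[OF writer_for[OF 1]])
      (use ls(1) in \<open>auto simp: store_apply agree_def represents_def stores_list_def\<close>)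
  have 3: "writer B {aReg, cReg} write_matrix (\<lambda>m. represents m n E \<and> stores_list m ls)
    (\<lambda>m. concat (map (\<lambda>i. map (\<lambda>j. {ls ! i, ls ! j} \<in> E) [0..<m mReg 0]) [0..<m mReg 0]))"
    unfolding write_matrix_def
    by (rule writer_cong[OF writer_for[OF 2]])
      (use ls(1) in \<open>auto simp: store_apply agree_def represents_def stores_list_def\<close>)
  show ?thesis by (rule writer_cong[OF 3]) (simp add: stores_list_def)
qed

lemma wp_write_instance:
  assumes rep: "represents m n E" and st: "stores_list m ls" and k: "m kReg 0 = k"
    and ls: "length ls \<le> B" "set ls \<subseteq> {..<n}" and B: "length (binary k) < B"
  shows "wp B write_instance (\<lambda>(m', xs', ys'). xs' = xs \<and> ys' = ys @ encode (relabelled ls E, k)) (m, xs, ys)"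
proof -
  have "writer B {} (Write (Equal (Const 0) (Const 0))) (\<lambda>m. True) (\<lambda>m. [True])"
    unfolding writer_def by (auto intro!: wp_Write simp: agree_refl)
  then have unary: "writer B {iReg} (for_loop iReg mReg (Write (Equal (Const 0) (Const 0))))
      (\<lambda>m. m mReg 0 \<le> B) (\<lambda>m. replicate (m mReg 0) True)"
    by (intro writer_cong[OF writer_for]) (auto simp: map_replicate_const)
  have mB: "m mReg 0 \<le> B" using st ls by (simp add: stores_list_def)
  show ?thesis unfolding write_instance_def
  proof (rule wp_Seq, rule wp_mono[OF unary[unfolded writer_def, rule_format, of m xs ys, OF mB]])
    fix s assume "case s of (m', xs', ys') \<Rightarrow>
      xs' = xs \<and> ys' = ys @ replicate (m mReg 0) True \<and> agree {iReg} m m'"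
    then obtain m' where s: "s = (m', xs, ys @ replicate (length ls) True)" and agr: "agree {iReg} m m'"
      using st by (auto simp: stores_list_def)
    have pre: "represents m' n E \<and> stores_list m' ls"
      using represents_agree[OF rep agr] st agreeD[OF agr] by (simp add: stores_list_def)
    show "wp B (Write (Less (Const 0) (Const 0)) ;; write_matrix ;; write_binary)
      (\<lambda>(m', xs', ys'). xs' = xs \<and> ys' = ys @ encode (relabelled ls E, k)) s"
      unfolding s
    proof (rule wp_Seq, rule wp_Write, rule wp_Seq,
        rule wp_mono[OF writer_write_matrix[OF ls, unfolded writer_def, rule_format, OF pre]])
      fix s
      let ?ys = "(ys @ replicate (length ls) True) @ [bval (Less (Const 0) (Const 0)) m']"
      let ?M = "concat (map (\<lambda>i. map (\<lambda>j. {ls ! i, ls ! j} \<in> E) [0..<length ls]) [0..<length ls])"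
      assume "case s of (m'', xs', ys') \<Rightarrow> xs' = xs \<and> ys' = ?ys @ ?M \<and> agree {aReg, cReg} m' m''"
      then obtain m'' where s: "s = (m'', xs, ?ys @ ?M)" and agr': "agree {aReg, cReg} m' m''" by auto
      have "m'' kReg 0 = k" using agreeD[OF agr] agreeD[OF agr'] k by simp
      from wp_write_binary[of m'' k B, OF this B]
      show "wp B write_binary (\<lambda>(m', xs', ys'). xs' = xs \<and> ys' = ys @ encode (relabelled ls E, k)) s"
        unfolding s by (rule wp_mono) (auto simp: encode_relabelled)
    qed
  qed
qed

section \<open>Reading the input\<close>

definition read_number :: com where
  "read_number = set_reg nReg (Const 0) ;; Read xReg (Const 0) ;;
     While (Equal (reg xReg) (Const 1)) (increment nReg ;; Read xReg (Const 0))"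

lemma wp_read_number:
  assumes "n \<le> B"
  shows "wp B read_number (\<lambda>(m', xs', ys'). xs' = xs \<and> ys' = ys \<and> m' nReg 0 = n)
    (m, replicate n True @ False # xs, ys)"
proof -
  have read: "wp B (Read xReg (Const 0)) (\<lambda>(m', xs', ys'). ys' = ys \<and> m' nReg 0 = m nReg 0 \<and>
      (m' xReg 0 = 1 \<and> (\<exists>r' < r. r = Suc r' \<and> xs' = replicate r' True @ False # xs) \<or>
       m' xReg 0 = 0 \<and> r = 0 \<and> xs' = xs)) (m, replicate r True @ False # xs, ys)" for m r
    by (cases r) (auto intro!: wp_Read_Cons simp: store_apply)
  show ?thesis unfolding read_number_def
  \<comment> \<open>Reading is one bit ahead of counting: \<open>v\<close> ones are still uncounted,
    and if \<open>v\<close> is positive, the first of them is already in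
    \<open>xReg\<close>.\<close>
  proof (rule wp_Seq, rule wp_Assign, rule wp_Seq, rule wp_mono[OF read],
      rule wp_While[where v = n and I = "\<lambda>v (m', xs', ys'). ys' = ys \<and> m' nReg 0 + v = n \<and>
      (m' xReg 0 = 1 \<and> (\<exists>r' < v. v = Suc r' \<and> xs' = replicate r' True @ False # xs) \<or>
       m' xReg 0 = 0 \<and> v = 0 \<and> xs' = xs)"])
    fix v :: nat and s :: config
    assume "case s of (m', xs', ys') \<Rightarrow> ys' = ys \<and> m' nReg 0 + v = n \<and>
      (m' xReg 0 = 1 \<and> (\<exists>r' < v. v = Suc r' \<and> xs' = replicate r' True @ False # xs) \<or>
       m' xReg 0 = 0 \<and> v = 0 \<and> xs' = xs)"
    then obtain m' xs' where s: "s = (m', xs', ys)" and inv: "m' nReg 0 + v = n"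
      "m' xReg 0 = 1 \<and> (\<exists>r' < v. v = Suc r' \<and> xs' = replicate r' True @ False # xs) \<or>
       m' xReg 0 = 0 \<and> v = 0 \<and> xs' = xs" by auto
    { assume "bval (Equal (reg xReg) (Const 1)) (fst s)"
      then obtain r where r: "v = Suc r" "xs' = replicate r True @ False # xs" using s inv by auto
      show "wp B (increment nReg ;; Read xReg (Const 0)) (\<lambda>s'. \<exists>v'<v. case s' of (m', xs', ys') \<Rightarrow>
        ys' = ys \<and> m' nReg 0 + v' = n \<and>
        (m' xReg 0 = 1 \<and> (\<exists>r' < v'. v' = Suc r' \<and> xs' = replicate r' True @ False # xs) \<or>
         m' xReg 0 = 0 \<and> v' = 0 \<and> xs' = xs)) s"
        unfolding s increment_def r(2)
      proof (rule wp_Seq, rule wp_Assign, rule wp_mono[OF read])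
        fix s' :: config
        assume "case s' of (m'', xs', ys') \<Rightarrow> ys' = ys \<and>
          m'' nReg 0 = store m' nReg (aval (Const 0) m') (aval (Add (reg nReg) (Const 1)) m') nReg 0 \<and>
          (m'' xReg 0 = 1 \<and> (\<exists>r' < r. r = Suc r' \<and> xs' = replicate r' True @ False # xs) \<or>
           m'' xReg 0 = 0 \<and> r = 0 \<and> xs' = xs)"
        then show "\<exists>v'<v. case s' of (m', xs', ys') \<Rightarrow> ys' = ys \<and> m' nReg 0 + v' = n \<and>
          (m' xReg 0 = 1 \<and> (\<exists>r' < v'. v' = Suc r' \<and> xs' = replicate r' True @ False # xs) \<or>
           m' xReg 0 = 0 \<and> v' = 0 \<and> xs' = xs)"
          using r inv by (intro exI[of _ r]) (auto simp: store_apply)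
      qed }
    { assume "\<not> bval (Equal (reg xReg) (Const 1)) (fst s)"
      then show "case s of (m', xs', ys') \<Rightarrow> xs' = xs \<and> ys' = ys \<and> m' nReg 0 = n" using s inv by auto }
  qed (use assms in \<open>auto simp: store_apply\<close>)
qed

text \<open>The offset of the next row is obtained from the current one by adding \<open>n\<close>,
  so the table of offsets is filled while the rows are read.\<close>

definition read_matrix :: com where
  "read_matrix = Assign rowA (Const 0) (Const 0) ;; for_loop aReg nReg
     (for_loop cReg nReg (Read adjA (Add (Cell rowA (reg aReg)) (reg cReg))) ;;
      Assign rowA (Add (reg aReg) (Const 1)) (Add (Cell rowA (reg aReg)) (reg nReg)))"

lemma wp_read_matrix:
  assumes n: "n \<le> B" and m: "m nReg 0 = n"
  shows "wp B read_matrix (\<lambda>(m', xs', ys'). xs' = xs \<and> ys' = ys \<and> represents m' n E)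
    (m, concat (map (\<lambda>i. map (\<lambda>j. {i, j} \<in> E) [0..<n]) [0..<n]) @ xs, ys)"
proof -
  let ?rows = "\<lambda>i. concat (map (\<lambda>i. map (\<lambda>j. {i, j} \<in> E) [0..<n]) [i..<n]) @ xs"
  \<comment> \<open>Row-major progress: all rows below \<open>i\<close> and the first
    \<open>j\<close> entries of row \<open>i\<close> are stored, and the offsets are known up to row
    \<open>i\<close> inclusive, where the next read takes place.\<close>
  let ?inv = "\<lambda>i j (m' :: memory). m' nReg 0 = n \<and> m' aReg 0 = i \<and> (\<forall>a \<le> i. m' rowA a = a * n) \<and>
    (\<forall>a b. (a < i \<or> a = i \<and> b < j) \<and> b < n \<longrightarrow> m' adjA (a * n + b) = of_bool ({a, b} \<in> E))"
  show ?thesis unfolding read_matrix_def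
  proof (rule wp_Seq, rule wp_Assign,
      rule wp_for[where n = n and I = "\<lambda>i (m', xs', ys'). xs' = ?rows i \<and> ys' = ys \<and> ?inv i 0 m'"])
    fix i m' xs' ys'
    assume i: "i < n" and "case (m', xs', ys') of (m', xs', ys') \<Rightarrow> xs' = ?rows i \<and> ys' = ys \<and> ?inv i 0 m'"
    then have io: "xs' = ?rows i" "ys' = ys" and inv: "?inv i 0 m'" by auto
    let ?rest = "\<lambda>j. map (\<lambda>j. {i, j} \<in> E) [j..<n] @ ?rows (Suc i)"
    have rows: "?rows i = ?rest 0" using i by (simp add: upt_conv_Cons)
    show "wp B (for_loop cReg nReg (Read adjA (Add (Cell rowA (reg aReg)) (reg cReg))) ;;
        Assign rowA (Add (reg aReg) (Const 1)) (Add (Cell rowA (reg aReg)) (reg nReg)))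
      (\<lambda>(m'', xs'', ys''). m'' aReg 0 = i \<and> (case (store m'' aReg 0 (Suc i), xs'', ys'') of (m', xs', ys') \<Rightarrow>
        xs' = ?rows (Suc i) \<and> ys' = ys \<and> ?inv (Suc i) 0 m')) (m', xs', ys')"
    proof (rule wp_Seq, rule wp_for[where n = n and I = "\<lambda>j (m', xs', ys').
        xs' = ?rest j \<and> ys' = ys \<and> ?inv i j m' \<and> m' cReg 0 = j"])
      fix j m'' xs'' ys''
      assume j: "j < n" and "case (m'', xs'', ys'') of (m', xs', ys') \<Rightarrow>
        xs' = ?rest j \<and> ys' = ys \<and> ?inv i j m' \<and> m' cReg 0 = j"
      then have io: "xs'' = ({i, j} \<in> E) # ?rest (Suc j)" "ys'' = ys" and inv': "?inv i j m''"
        and c: "m'' cReg 0 = j" by (auto simp: upt_conv_Cons)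
      let ?m = "store m'' adjA (i * n + j) (of_bool ({i, j} \<in> E))"
      have adj: "?m adjA (a * n + b) = of_bool ({a, b} \<in> E)"
        if "(a < i \<or> a = i \<and> b < Suc j) \<and> b < n" for a b
      proof (cases "a = i \<and> b = j")
        case False
        then have "a * n + b \<noteq> i * n + j" using index_inject[of b n j a i] that j by blast
        then have "?m adjA (a * n + b) = m'' adjA (a * n + b)" by (simp add: store_def)
        moreover have "(a < i \<or> a = i \<and> b < j) \<and> b < n" using that False by auto
        then have "m'' adjA (a * n + b) = of_bool ({a, b} \<in> E)" using inv' by blast
        ultimately show ?thesis by (rule trans)
      qed (simp add: store_def)
      have addr: "aval (Add (Cell rowA (reg aReg)) (reg cReg)) m'' = i * n + j" using inv' c by simp
      show "wp B (Read adjA (Add (Cell rowA (reg aReg)) (reg cReg))) (\<lambda>(m', xs', ys'). m' cReg 0 = j \<and>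
        (case (store m' cReg 0 (Suc j), xs', ys') of (m', xs', ys') \<Rightarrow>
        xs' = ?rest (Suc j) \<and> ys' = ys \<and> ?inv i (Suc j) m' \<and> m' cReg 0 = Suc j)) (m'', xs'', ys'')"
        unfolding io
      proof (rule wp_Read_Cons, unfold addr)
        have "?m x = m'' x" if "x \<noteq> adjA" for x using that by (simp add: store_def)
        moreover have "store ?m cReg 0 (Suc j) x = ?m x" if "x \<noteq> cReg" for x using that by (simp add: store_def)
        moreover have "store ?m cReg 0 (Suc j) cReg 0 = Suc j" by (simp add: store_def)
        ultimately show "case (?m, ?rest (Suc j), ys) of (m', xs', ys') \<Rightarrow> m' cReg 0 = j \<and>
          (case (store m' cReg 0 (Suc j), xs', ys') of (m', xs', ys') \<Rightarrow>
          xs' = ?rest (Suc j) \<and> ys' = ys \<and> ?inv i (Suc j) m' \<and> m' cReg 0 = Suc j)"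
          using inv' c adj by (simp del: of_bool_eq_iff)
      qed
    next
      fix s assume "case s of (m', xs', ys') \<Rightarrow> xs' = ?rest n \<and> ys' = ys \<and> ?inv i n m' \<and> m' cReg 0 = n"
      then obtain m'' where s: "s = (m'', ?rows (Suc i), ys)" and inv': "?inv i n m''" by auto
      let ?m = "store (store m'' rowA (Suc i) (Suc i * n)) aReg 0 (Suc i)"
      have "?m nReg 0 = n" "?m aReg 0 = Suc i" "?m adjA = m'' adjA" using inv' by (auto simp: store_def)
      moreover have "?m rowA a = a * n" if "a \<le> Suc i" for a
        using inv' that by (auto simp: store_def le_Suc_eq)
      ultimately have inv_Suc: "?inv (Suc i) 0 ?m" using inv' by (simp add: less_Suc_eq)
      have a: "store m'' rowA (Suc i) (Suc i * n) aReg 0 = i" using inv' by (simp add: store_def)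
      have eq: "store m'' rowA (aval (Add (reg aReg) (Const 1)) m'') (aval (Add (Cell rowA (reg aReg)) (reg nReg)) m'')
        = store m'' rowA (Suc i) (Suc i * n)" using inv' by (simp add: add.commute)
      show "wp B (Assign rowA (Add (reg aReg) (Const 1)) (Add (Cell rowA (reg aReg)) (reg nReg)))
        (\<lambda>(m'', xs'', ys''). m'' aReg 0 = i \<and> (case (store m'' aReg 0 (Suc i), xs'', ys'') of (m', xs', ys') \<Rightarrow>
          xs' = ?rows (Suc i) \<and> ys' = ys \<and> ?inv (Suc i) 0 m')) s"
        unfolding s by (rule wp_Assign, unfold eq prod.case) (use inv_Suc a in blast)
    qed (use inv io rows n in \<open>auto simp: store_def\<close>)
  next
    fix s assume "case s of (m', xs', ys') \<Rightarrow> xs' = ?rows n \<and> ys' = ys \<and> ?inv n 0 m'"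
    then show "case s of (m', xs', ys') \<Rightarrow> xs' = xs \<and> ys' = ys \<and> represents m' n E"
      by (auto simp: represents_def)
  qed (use n m in \<open>auto simp: store_def\<close>)
qed

definition read_binary :: com where
  "read_binary = set_reg kReg (Const 0) ;; Read xReg (Const 0) ;;
     While (Less (reg xReg) (Const 2))
       (set_reg kReg (Add (double (reg kReg)) (reg xReg)) ;; Read xReg (Const 0))"

text \<open>Horner's scheme with the value of the bits already consumed as accumulator.\<close>

definition bits_value :: "nat \<Rightarrow> bool list \<Rightarrow> nat" where
  "bits_value = foldl (\<lambda>k b. 2 * k + of_bool b)"

lemma bits_value_binary: "bits_value 0 (binary k) = k"
proof (induction k rule: less_induct)
  case (less k)
  show ?case
  proof (cases "k = 0")
    case False
    then have "bits_value 0 (binary k) = 2 * (k div 2) + of_bool (odd k)"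
      using less by (simp add: binary_pos bits_value_def)
    then show ?thesis by (simp add: of_bool_odd_eq_mod_2)
  qed (simp add: binary_0 bits_value_def)
qed

lemma wp_read_binary:
  assumes B: "length (binary k) < B"
  shows "wp B read_binary (\<lambda>(m', xs', ys'). ys' = ys \<and> agree {kReg, xReg} m m' \<and> m' kReg 0 = k)
    (m, binary k, ys)"
proof -
  \<comment> \<open>\<open>bs\<close> are the bits not yet absorbed into \<open>kReg\<close>. The
    first of them is already in \<open>xReg\<close>; the value 2 there signals that none is
    left.\<close>
  let ?next = "\<lambda>bs (m' :: memory) xs'. case bs of [] \<Rightarrow> m' xReg 0 = 2 \<and> xs' = []
      | b # bs' \<Rightarrow> m' xReg 0 = of_bool b \<and> xs' = bs'"
  have read: "wp B (Read xReg (Const 0)) (\<lambda>(m', xs', ys'). ys' = ys \<and> agree {xReg} m m' \<and> ?next bs m' xs') (m, bs, ys)" for m bs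
    by (cases bs) (auto intro!: wp_Read_Cons wp_Read_Nil simp: store_def agree_def)
  show ?thesis unfolding read_binary_def
  proof (rule wp_Seq, rule wp_Assign, rule wp_Seq, rule wp_mono[OF read],
      rule wp_While[where v = "length (binary k)" and I = "\<lambda>v (m', xs', ys'). ys' = ys \<and>
      agree {kReg, xReg} m m' \<and> (\<exists>bs. length bs = v \<and> ?next bs m' xs' \<and> bits_value (m' kReg 0) bs = k)"])
    fix s assume "case s of (m', xs', ys') \<Rightarrow>
      ys' = ys \<and> agree {xReg} (store m kReg (aval (Const 0) m) (aval (Const 0) m)) m' \<and> ?next (binary k) m' xs'"
    then show "case s of (m', xs', ys') \<Rightarrow> ys' = ys \<and>
      agree {kReg, xReg} m m' \<and> (\<exists>bs. length bs = length (binary k) \<and> ?next bs m' xs' \<and>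
        bits_value (m' kReg 0) bs = k)"
      by (auto simp: agree_def store_def bits_value_binary intro!: exI[of _ "binary k"])
  next
    fix v s assume "case s of (m', xs', ys') \<Rightarrow> ys' = ys \<and>
      agree {kReg, xReg} m m' \<and> (\<exists>bs. length bs = v \<and> ?next bs m' xs' \<and> bits_value (m' kReg 0) bs = k)"
    then obtain m' xs' bs where s: "s = (m', xs', ys)" and agr: "agree {kReg, xReg} m m'"
      and bs: "length bs = v" "?next bs m' xs'" "bits_value (m' kReg 0) bs = k" by auto
    { assume "bval (Less (reg xReg) (Const 2)) (fst s)"
      then obtain b where bs': "bs = b # xs'" "m' xReg 0 = of_bool b"
        using s bs(2) by (auto split: list.splits)
      let ?m = "store m' kReg 0 (2 * m' kReg 0 + of_bool b)"
      have val: "bits_value (?m kReg 0) xs' = k" using bs(3) bs'(1) by (simp add: bits_value_def store_def)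
      show "wp B (set_reg kReg (Add (double (reg kReg)) (reg xReg)) ;; Read xReg (Const 0))
        (\<lambda>s'. \<exists>v'<v. case s' of (m', xs', ys') \<Rightarrow> ys' = ys \<and>
        agree {kReg, xReg} m m' \<and> (\<exists>bs. length bs = v' \<and> ?next bs m' xs' \<and> bits_value (m' kReg 0) bs = k)) s"
        unfolding s
      proof (rule wp_Seq, rule wp_Assign, rule wp_mono[OF read])
        fix s' assume "case s' of (m'', xs'', ys') \<Rightarrow> ys' = ys \<and>
          agree {xReg} (store m' kReg (aval (Const 0) m') (aval (Add (double (reg kReg)) (reg xReg)) m')) m'' \<and>
          ?next xs' m'' xs''"
        then obtain m'' xs'' where s': "s' = (m'', xs'', ys)" and agr': "agree {xReg} ?m m''"
          and nx: "?next xs' m'' xs''" using bs'(2) by (auto simp: double_def mult_2)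
        have "bits_value (m'' kReg 0) xs' = k" using val agreeD[OF agr', of kReg] by simp
        moreover have "agree {kReg, xReg} m m''" using agr agr' by (auto simp: agree_def store_def)
        ultimately show "\<exists>v'<v. case s' of (m', xs', ys') \<Rightarrow> ys' = ys \<and>
          agree {kReg, xReg} m m' \<and> (\<exists>bs. length bs = v' \<and> ?next bs m' xs' \<and> bits_value (m' kReg 0) bs = k)"
          unfolding s' using bs(1) bs'(1) nx by (intro exI[of _ "length xs'"]) auto
      qed }
    { assume "\<not> bval (Less (reg xReg) (Const 2)) (fst s)"
      then have "bs = []" using s bs(2) by (auto split: list.splits simp: of_bool_def split: if_splits)
      then show "case s of (m', xs', ys') \<Rightarrow> ys' = ys \<and> agree {kReg, xReg} m m' \<and> m' kReg 0 = k"
        using s agr bs(3) by (simp add: bits_value_def) }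
  qed (use B in simp)
qed

section \<open>The complete program and its correctness\<close>

definition no_instance :: "nat graph \<times> nat" where
  "no_instance = (({..<4}, {{0, 1}, {1, 2}, {2, 3}}), 0)"

lemma no_instance_obstruction: "obstruction (edges (fst no_instance)) 0 1 2 3"
  by (simp add: no_instance_def obstruction_def doubleton_eq_iff)

lemma no_instance_edges: "edges (fst no_instance) \<subseteq> [verts (fst no_instance)]\<^bsup>2\<^esup>"
  by (simp add: no_instance_def nsets_def)

definition kernelize :: com where
  "kernelize = read_number ;; read_matrix ;; read_binary ;; reduce ;; collect_core ;; square ;;
     Cond (Less (double (double (double (double (reg sqReg))))) (reg mReg))
       (write_bits (encode no_instance)) write_instance"

text \<open>A no-instance with parameter 0 must be mapped to a graph that is not trivially perfect,
  hence has at least four vertices; \<open>max 1\<close> keeps the bound positive there.\<close>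

definition kernel_of :: "nat graph \<times> nat \<Rightarrow> nat graph \<times> nat \<Rightarrow> bool" where
  "kernel_of I I' \<longleftrightarrow> I' \<in> graph_instances \<and> (TPC (fst I) (snd I) \<longleftrightarrow> TPC (fst I') (snd I')) \<and>
     snd I' \<le> snd I \<and> card (verts (fst I')) \<le> 16 * (max 1 (snd I)) ^ 7"

lemma kernel_of_no_instance:
  assumes "\<not> TPC G k"
  shows "kernel_of (G, k) no_instance"
proof -
  note V = no_instance_edges
  have "\<not> TPC (fst no_instance) 0"
  proof
    assume "TPC (fst no_instance) 0"
    then have "TPC (verts (fst no_instance), edges (fst no_instance)) 0" by simp
    then obtain S where S: "S \<subseteq> [verts (fst no_instance)]\<^bsup>2\<^esup> - edges (fst no_instance)" "card S \<le> 0"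
      "\<And>a b c d. \<not> obstruction (edges (fst no_instance) \<union> S) a b c d"
      unfolding TPC_iff[OF V] by blast
    have "finite S"
      using S(1) by (rule finite_subset) (simp add: no_instance_def finite_imp_finite_nsets)
    then have "S = {}" using S(2) by simp
    with S(3) no_instance_obstruction show False by simp
  qed
  moreover have "no_instance \<in> graph_instances"
    using V by (auto simp: graph_instances_def simple_graph_def no_instance_def)
  moreover have "(1::nat) \<le> (max 1 k) ^ 7" by (rule one_le_power) simp
  ultimately show ?thesis
    using assms by (auto simp: kernel_of_def no_instance_def)
qed

lemma filter_core_facts:
  assumes E: "E \<subseteq> [{..<n}]\<^bsup>2\<^esup>"
  defines "ls \<equiv> filter (\<lambda>v. v \<in> core E) [0..<n]"
  shows "set ls = core E" "distinct ls" "length ls = card (core E)" "length ls \<le> n"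
proof -
  show set: "set ls = core E" using core_subset[OF E] by (auto simp: ls_def)
  show dist: "distinct ls" by (simp add: ls_def)
  show "length ls = card (core E)" using distinct_card[OF dist] set by simp
  show "length ls \<le> n" unfolding ls_def using length_filter_le[of _ "[0..<n]"] by simp
qed

lemma kernel_of_relabelled:
  assumes E: "E \<subseteq> [{..<n}]\<^bsup>2\<^esup>" and eq: "TPC ({..<n}, E) k' \<longleftrightarrow> TPC G k" and k: "k' \<le> k"
    and small: "card (core E) \<le> 16 * (k' * k')"
  shows "kernel_of (G, k) (relabelled (filter (\<lambda>v. v \<in> core E) [0..<n]) E, k')"
proof -
  let ?ls = "filter (\<lambda>v. v \<in> core E) [0..<n]"
  let ?m = "length ?ls" and ?C = "restrict_edges E (core E)"
  note ls = filter_core_facts[OF E]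
  have bij: "bij_betw ((!) ?ls) {..<?m} (core E)"
    using bij_betw_nth[OF ls(2)] ls(1) by simp
  have fin: "finite (core E)" using core_subset[OF E] finite_subset by blast
  have "?ls ! i \<in> core E" if "i < ?m" for i using ls(1) nth_mem[OF that] by simp
  then have "{?ls ! i, ?ls ! j} \<in> E \<longleftrightarrow> {?ls ! i, ?ls ! j} \<in> ?C" if "i < ?m" "j < ?m" for i j
    using that by (simp add: restrict_edges_def)
  then have rel: "relabelled ?ls E = ({..<?m}, {{i, j} | i j. i < ?m \<and> j < ?m \<and> {?ls ! i, ?ls ! j} \<in> ?C})"
    unfolding relabelled_def by blast
  note relabel = TPC_relabel[OF fin bij restrict_edges_nsets[OF E]]
  have "(relabelled ?ls E, k') \<in> graph_instances"
    using relabel(1) unfolding rel graph_instances_def simple_graph_def by auto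
  moreover have "TPC (relabelled ?ls E) k' \<longleftrightarrow> TPC G k"
    unfolding rel relabel(2) TPC_restrict_core[OF finite_lessThan E, symmetric] by (rule eq)
  moreover have "card (verts (relabelled ?ls E)) \<le> 16 * (max 1 k) ^ 7"
  proof -
    have "card (verts (relabelled ?ls E)) \<le> 16 * (k' * k')"
      using small ls(3) by (simp add: relabelled_def)
    also have "k' * k' \<le> max 1 k ^ 2" unfolding power2_eq_square using k by (intro mult_mono) auto
    also have "max 1 k ^ 2 \<le> max 1 k ^ 7" by (rule power_increasing) simp_all
    finally show ?thesis by simp
  qed
  ultimately show ?thesis using k by (simp add: kernel_of_def)
qed

text \<open>\<open>B\<close> exceeds the length of the encoding. This covers all loops, whose
  iterations are governed by vertices, by missing edges (at most \<open>n * n\<close>), or by bits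
  of the parameter.\<close>

lemma wp_kernelize:
  assumes E: "E \<subseteq> [{..<n}]\<^bsup>2\<^esup>" and B: "n * n + n + 1 + length (binary k) < B"
  shows "wp B kernelize (\<lambda>(m', xs', ys'). \<exists>I'. kernel_of (({..<n}, E), k) I' \<and> ys' = encode I')
    (m, encode (({..<n}, E), k), [])"
proof -
  let ?post = "\<lambda>(m' :: memory, xs' :: bool list, ys'). \<exists>I'. kernel_of (({..<n}, E), k) I' \<and> ys' = encode I'"
  have nB: "n \<le> B" "n < B" and kB: "length (binary k) < B" using B by auto
  have "missing n E \<le> card ([{..<n}]\<^bsup>2\<^esup>)"
    unfolding missing_def by (rule card_mono) (auto simp: finite_imp_finite_nsets)
  also have "\<dots> = n choose 2" by (simp add: card_nsets)
  also have "\<dots> \<le> n * n"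
    unfolding choose_two by (rule order_trans[OF div_le_dividend mult_le_mono2[OF diff_le_self]])
  finally have miss: "missing n E < B" using B by simp
  have enc: "encode (({..<n}, E), k) = replicate n True @ False #
      (concat (map (\<lambda>i. map (\<lambda>j. {i, j} \<in> E) [0..<n]) [0..<n]) @ binary k)"
    by (simp add: encode_def)
  let ?out = "Cond (Less (double (double (double (double (reg sqReg))))) (reg mReg))
    (write_bits (encode no_instance)) write_instance"
  show ?thesis unfolding kernelize_def enc
  proof (rule wp_Seq_mono[OF wp_read_number[OF nB(1)]])
    fix s :: config
    let ?M = "concat (map (\<lambda>i. map (\<lambda>j. {i, j} \<in> E) [0..<n]) [0..<n])"
    assume "case s of (m', xs', ys') \<Rightarrow> xs' = ?M @ binary k \<and> ys' = [] \<and> m' nReg 0 = n"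
    then obtain m1 where s: "s = (m1, ?M @ binary k, [])" and m1: "m1 nReg 0 = n" by auto
    show "wp B (read_matrix ;; read_binary ;; reduce ;; collect_core ;; square ;; ?out) ?post s"
      unfolding s
    proof (rule wp_Seq_mono[OF wp_read_matrix[of n B m1, OF nB(1) m1]])
      fix s :: config
      assume "case s of (m', xs', ys') \<Rightarrow> xs' = binary k \<and> ys' = [] \<and> represents m' n E"
      then obtain m2 where s: "s = (m2, binary k, [])" and rep: "represents m2 n E" by auto
      show "wp B (read_binary ;; reduce ;; collect_core ;; square ;; ?out) ?post s"
        unfolding s
      proof (rule wp_Seq_mono[OF wp_read_binary[OF kB]])
        fix s :: config
        assume "case s of (m', xs', ys') \<Rightarrow> ys' = [] \<and> agree {kReg, xReg} m2 m' \<and> m' kReg 0 = k"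
        then obtain m3 xs3 where s: "s = (m3, xs3, [])" and agr: "agree {kReg, xReg} m2 m3"
          and k: "m3 kReg 0 = k" by auto
        have "represents m3 n E" using represents_agree[OF rep agr] by simp
        then have val: "valid n E k m3 E" using E k by (simp add: valid_def)
        show "wp B (reduce ;; collect_core ;; square ;; ?out) ?post s"
          unfolding s
        proof (rule wp_Seq_mono[OF wp_reduce[OF nB(1) val miss]])
          fix s :: config
          assume "case s of (m', xs', ys') \<Rightarrow> xs' = xs3 \<and> ys' = [] \<and>
            (\<exists>E'. valid n E k m' E' \<and> reduced (m' kReg 0) E')"
          then obtain m4 E' where s: "s = (m4, xs3, [])" and val4: "valid n E k m4 E'"
            and red: "reduced (m4 kReg 0) E'" by auto
          let ?k = "m4 kReg 0" and ?ls = "filter (\<lambda>v. v \<in> core E') [0..<n]"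
          have E': "E' \<subseteq> [{..<n}]\<^bsup>2\<^esup>" and k4: "?k \<le> k"
            and eq: "TPC ({..<n}, E') ?k \<longleftrightarrow> TPC ({..<n}, E) k" using val4 by (auto simp: valid_def)
          note ls = filter_core_facts[OF E']
          show "wp B (collect_core ;; square ;; ?out) ?post s"
            unfolding s
          proof (rule wp_Seq_mono[OF wp_collect_core[OF nB(1) val4 refl]])
            fix s :: config
            assume "case s of (m', xs', ys') \<Rightarrow> xs' = xs3 \<and> ys' = [] \<and> valid n E k m' E' \<and>
              m' kReg 0 = ?k \<and> stores_list m' ?ls"
            then obtain m5 where s: "s = (m5, xs3, [])" and val5: "valid n E k m5 E'"
              and k5: "m5 kReg 0 = ?k" and st: "stores_list m5 ?ls" by auto
            have n5: "m5 nReg 0 = n" using val5 by (simp add: valid_def represents_def)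
            show "wp B (square ;; ?out) ?post s"
              unfolding s
            proof (rule wp_Seq_mono[OF wp_square[of n B m5 ?k, OF nB(2) n5 k5]])
              fix s :: config
              assume "case s of (m', xs', ys') \<Rightarrow> xs' = xs3 \<and> ys' = [] \<and> agree {sqReg, iReg} m5 m' \<and>
                (m' sqReg 0 = ?k * ?k \<or> n < m' sqReg 0 \<and> m' sqReg 0 \<le> ?k * ?k)"
              then obtain m6 where s: "s = (m6, xs3, [])" and agr6: "agree {sqReg, iReg} m5 m6"
                and sq: "m6 sqReg 0 = ?k * ?k \<or> n < m6 sqReg 0 \<and> m6 sqReg 0 \<le> ?k * ?k" by auto
              have st6: "stores_list m6 ?ls" using st agreeD[OF agr6] by (simp add: stores_list_def)
              have rep6: "represents m6 n E'"
                using represents_agree[OF _ agr6, of n E'] val5 by (simp add: valid_def)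
              have k6: "m6 kReg 0 = ?k" using agreeD[OF agr6, of kReg] k5 by simp
              \<comment> \<open>If the squaring stopped early, both sides are false: the partial sum
                and the true square exceed \<open>n\<close>, and the core has at most
                \<open>n\<close> vertices.\<close>
              have test: "16 * m6 sqReg 0 < m6 mReg 0 \<longleftrightarrow> 16 * (?k * ?k) < card (core E')"
                using sq st6 ls(3,4) by (auto simp: stores_list_def)
              have lsB: "length ?ls \<le> B" "set ?ls \<subseteq> {..<n}" using ls(4) nB by auto
              have binB: "length (binary ?k) < B" using length_binary_mono[OF k4] kB by simp
              show "wp B ?out ?post s"
                unfolding s
              proof (rule wp_Cond)
                assume "bval (Less (double (double (double (double (reg sqReg))))) (reg mReg)) (fst (m6, xs3, []))"
                then have "16 * m6 sqReg 0 < m6 mReg 0" by (simp add: double_def)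
                \<comment> \<open>Contraposition of \<open>card_core_le\<close>: a reduced
                  yes-instance cannot have so large a core.\<close>
                then have "\<not> TPC ({..<n}, E') ?k"
                  using test card_core_le[OF finite_lessThan E', of ?k] red by (auto simp: reduced_def)
                then have "kernel_of (({..<n}, E), k) no_instance" using eq kernel_of_no_instance by blast
                then show "wp B (write_bits (encode no_instance)) ?post (m6, xs3, [])"
                  by (intro wp_write_bits, unfold prod.case append_Nil) blast
              next
                assume "\<not> bval (Less (double (double (double (double (reg sqReg))))) (reg mReg)) (fst (m6, xs3, []))"
                then have "\<not> 16 * m6 sqReg 0 < m6 mReg 0" by (simp add: double_def)
                then have "card (core E') \<le> 16 * (?k * ?k)" using test by simp
                then have "kernel_of (({..<n}, E), k) (relabelled ?ls E', ?k)"
                  by (rule kernel_of_relabelled[OF E' eq k4])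
                then show "wp B write_instance ?post (m6, xs3, [])"
                  by (intro wp_mono[OF wp_write_instance[OF rep6 st6 k6 lsB binB]],
                      simp only: split_paired_all prod.case append_Nil) blast
              qed
            qed
          qed
        qed
      qed
    qed
  qed
qed

theorem theorem3:
  shows "\<exists>(f :: nat graph \<times> nat \<Rightarrow> nat graph \<times> nat) (c :: nat).
     poly_time_computable encode graph_instances f \<and>
     (\<forall>(G, k) \<in> graph_instances. \<forall>G' k'. f (G, k) = (G', k') \<longrightarrow>
        (G', k') \<in> graph_instances \<and>
        (TPC G k \<longleftrightarrow> TPC G' k') \<and>
        k' \<le> k \<and>
        card (verts G') \<le> c * (max 1 k) ^ 7)"
proof -
  let ?run = "\<lambda>I I'. kernel_of I I' \<and> (\<exists>t m xs. exec kernelize (\<lambda>_ _. 0, encode I, []) t (m, xs, encode I') \<and>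
      t \<le> time_bound (length (encode I) + 1) kernelize)"
  have "\<exists>I'. ?run I I'" if I: "I \<in> graph_instances" for I
  proof -
    obtain n E k where I': "I = (({..<n}, E), k)" and E: "E \<subseteq> [{..<n}]\<^bsup>2\<^esup>"
      using I by (cases I) (auto simp: graph_instances_def simple_graph_def)
    have "length (encode I) = n * n + n + 1 + length (binary k)"
      by (simp add: I' encode_def length_concat comp_def sum_list_triv)
    then have "n * n + n + 1 + length (binary k) < length (encode I) + 1" by simp
    from wp_kernelize[OF E this, of "\<lambda>_ _. 0"] obtain t s' where
      run: "exec kernelize (\<lambda>_ _. 0, encode I, []) t s'" "t \<le> time_bound (length (encode I) + 1) kernelize"
      and post: "case s' of (m, xs, ys) \<Rightarrow> \<exists>I'. kernel_of I I' \<and> ys = encode I'"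
      unfolding I' by (rule wpE)
    from post obtain m xs I' where "s' = (m, xs, encode I')" "kernel_of I I'"
      by (cases s') blast
    with run show ?thesis by blast
  qed
  \<comment> \<open>For each instance the program has a halting run whose output encodes some
    kernel; \<open>f\<close> selects that kernel.\<close>
  then obtain f where f: "\<And>I. I \<in> graph_instances \<Longrightarrow> ?run I (f I)" by metis
  obtain p :: "nat poly" where p: "\<And>B. time_bound B kernelize = poly p B"
    using time_bound_poly by blast
  have "poly_time_computable encode graph_instances f"
    unfolding poly_time_computable_def
  \<comment> \<open>The loop bound was taken as input length plus 1, so the polynomial
    \<open>p\<close> is composed with \<open>x + 1\<close>.\<close>
  proof (rule exI[of _ kernelize], rule exI[of _ "pcompose p [:1, 1:]"], rule ballI)
    fix I assume "I \<in> graph_instances"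
    then obtain t m xs where "exec kernelize (\<lambda>_ _. 0, encode I, []) t (m, xs, encode (f I))"
      "t \<le> time_bound (length (encode I) + 1) kernelize" using f by blast
    then show "\<exists>t m xs. exec kernelize (\<lambda>_ _. 0, encode I, []) t (m, xs, encode (f I)) \<and>
        t \<le> poly (pcompose p [:1, 1:]) (length (encode I))"
      by (auto simp: poly_pcompose p)
  qed
  moreover have "\<forall>(G, k) \<in> graph_instances. \<forall>G' k'. f (G, k) = (G', k') \<longrightarrow>
        (G', k') \<in> graph_instances \<and> (TPC G k \<longleftrightarrow> TPC G' k') \<and> k' \<le> k \<and>
        card (verts G') \<le> 16 * (max 1 k) ^ 7"
    using f by (fastforce simp: kernel_of_def)
  ultimately show ?thesis by blast
qed

end
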